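(* Let $k$ be a field, let $n$ be a positive integer, and let $D_n(k) = \operatorname{Fract} A_n(k)$ be the $n$-th Weyl skew field over $k$. Then the following three conditions are equivalent: (1) $D_n(k)$ is affine over its center; (2) $D_n(k)$ is finite dimensional over its center; (3) $\operatorname{char} k > 0$. However, $D_n(k)$ is never affine over $k$ (for any field $k$ and any $n \ge 1$).
   Context: All rings are associative with unit. The field $k$ is arbitrary (commutative; finite, countable or uncountable). $A_n(k)$ is the $n$-th Weyl algebra: the $k$-algebra generated by $x_1,\dots,x_n,y_1,\dots,y_n$ with relations $x_ix_j=x_jx_i$, $y_iy_j=y_jy_i$, $y_ix_j-x_jy_i=\delta_{ij}$ for all $i,j$. It is a noetherian domain, and $\operatorname{Fract} A_n(k)$ denotes its division ring of fractions. A division algebra $D$ is called affine over a central subfield $F$ if $D$ is finitely generated as an $F$-algebra (as a ring over $F$, not merely as a skew field). *)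

theory Defs
  imports
    "HOL-Library.Poly_Mapping"
    "HOL-Computational_Algebra.Computational_Algebra"
begin

text \<open>The free monoid, written additively because the monoid algebra construction
  \<^typ>\<open>'a \<Rightarrow>\<^sub>0 'b\<close> of \<^theory>\<open>HOL-Library.Poly_Mapping\<close> expects additive exponents.\<close>

datatype 'g free_monoid = Word (letters: "'g list")

instantiation free_monoid :: (type) monoid_add
begin

definition zero_free_monoid :: "'a free_monoid"
  where "0 = Word []"

definition plus_free_monoid :: "'a free_monoid \<Rightarrow> 'a free_monoid \<Rightarrow> 'a free_monoid"
  where "u + v = Word (letters u @ letters v)"

instance
  by standard (simp_all add: zero_free_monoid_def plus_free_monoid_def)

end

type_synonym ('k, 'g) free_algebra = "'g free_monoid \<Rightarrow>\<^sub>0 'k"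

definition fa_const :: "'k::ring_1 \<Rightarrow> ('k, 'g) free_algebra"
  where "fa_const c = Poly_Mapping.single 0 c"

definition fa_gen :: "'g \<Rightarrow> ('k::ring_1, 'g) free_algebra"
  where "fa_gen g = Poly_Mapping.single (Word [g]) 1"


text \<open>The number of pairs of generators is the cardinality of the index type \<^typ>\<open>'n\<close>.\<close>

datatype 'n weyl_gen = GenX 'n | GenY 'n

inductive_set weyl_relators :: "('k::field, 'n weyl_gen) free_algebra set" where
  xx: "fa_gen (GenX i) * fa_gen (GenX j) - fa_gen (GenX j) * fa_gen (GenX i) \<in> weyl_relators"
| yy: "fa_gen (GenY i) * fa_gen (GenY j) - fa_gen (GenY j) * fa_gen (GenY i) \<in> weyl_relators"
| yx: "fa_gen (GenY i) * fa_gen (GenX j) - fa_gen (GenX j) * fa_gen (GenY i)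
         - (if i = j then 1 else 0) \<in> weyl_relators"

inductive_set two_sided_ideal :: "'a::ring_1 set \<Rightarrow> 'a set" for R :: "'a set" where
  zero: "0 \<in> two_sided_ideal R"
| incl: "r \<in> R \<Longrightarrow> r \<in> two_sided_ideal R"
| add: "a \<in> two_sided_ideal R \<Longrightarrow> b \<in> two_sided_ideal R \<Longrightarrow> a + b \<in> two_sided_ideal R"
| mult_left: "a \<in> two_sided_ideal R \<Longrightarrow> c * a \<in> two_sided_ideal R"
| mult_right: "a \<in> two_sided_ideal R \<Longrightarrow> a * c \<in> two_sided_ideal R"

lemma two_sided_ideal_uminus: "a \<in> two_sided_ideal R \<Longrightarrow> - a \<in> two_sided_ideal R"
  using two_sided_ideal.mult_left[of a R "-1"] by simp

lemma two_sided_ideal_diff: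
  "a \<in> two_sided_ideal R \<Longrightarrow> b \<in> two_sided_ideal R \<Longrightarrow> a - b \<in> two_sided_ideal R"
  using two_sided_ideal.add[OF _ two_sided_ideal_uminus] by fastforce

definition weyl_cong ::
    "('k::field, 'n weyl_gen) free_algebra \<Rightarrow> ('k, 'n weyl_gen) free_algebra \<Rightarrow> bool"
  where "weyl_cong a b \<longleftrightarrow> a - b \<in> two_sided_ideal weyl_relators"

lemma equivp_weyl_cong: "equivp weyl_cong"
proof (rule equivpI)
  show "reflp weyl_cong"
    by (simp add: reflp_def weyl_cong_def two_sided_ideal.zero)
  show "symp weyl_cong"
    using two_sided_ideal_uminus by (fastforce simp: symp_def weyl_cong_def)
  show "transp weyl_cong"
    using two_sided_ideal.add by (fastforce simp: transp_def weyl_cong_def)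
qed

text \<open>
  To see that the quotient is not the zero ring, let the free algebra act on functions
  \<open>f :: ('n \<Rightarrow> nat) \<Rightarrow> 'k\<close>, read as formal power series \<open>\<Sum>m. f m * x^m\<close>: the generator
  \<open>x\<^sub>i\<close> multiplies by \<open>x\<^sub>i\<close>, and \<open>y\<^sub>i\<close> is the partial derivative in \<open>x\<^sub>i\<close>.
\<close>

fun gen_act :: "'n weyl_gen \<Rightarrow> (('n \<Rightarrow> nat) \<Rightarrow> 'k::field) \<Rightarrow> ('n \<Rightarrow> nat) \<Rightarrow> 'k" where
  "gen_act (GenX i) f m = (if m i = 0 then 0 else f (m(i := m i - 1)))"
| "gen_act (GenY i) f m = of_nat (m i + 1) * f (m(i := m i + 1))"

definition word_act :: "'n weyl_gen free_monoid \<Rightarrow> (('n \<Rightarrow> nat) \<Rightarrow> 'k::field) \<Rightarrow> ('n \<Rightarrow> nat) \<Rightarrow> 'k"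
  where "word_act w f = foldr gen_act (letters w) f"

definition fa_act ::
    "('k::field, 'n weyl_gen) free_algebra \<Rightarrow> (('n \<Rightarrow> nat) \<Rightarrow> 'k) \<Rightarrow> ('n \<Rightarrow> nat) \<Rightarrow> 'k"
  where "fa_act a f m = (\<Sum>w. Poly_Mapping.lookup a w * word_act w f m)"

lemma gen_act_linear:
  "gen_act g (\<lambda>m. f m + h m) = (\<lambda>m. gen_act g f m + gen_act g h m)"
  "gen_act g (\<lambda>m. c * f m) = (\<lambda>m. c * gen_act g f m)"
  by (cases g; auto simp: fun_eq_iff algebra_simps)+

lemma word_act_linear:
  "word_act w (\<lambda>m. f m + h m) = (\<lambda>m. word_act w f m + word_act w h m)"
  "word_act w (\<lambda>m. c * f m) = (\<lambda>m. c * word_act w f m)"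
proof -
  have "foldr gen_act xs (\<lambda>m. f m + h m) = (\<lambda>m. foldr gen_act xs f m + foldr gen_act xs h m)"
    "foldr gen_act xs (\<lambda>m. c * f m) = (\<lambda>m. c * foldr gen_act xs f m)" for xs
    by (induction xs) (simp_all add: gen_act_linear)
  then show "word_act w (\<lambda>m. f m + h m) = (\<lambda>m. word_act w f m + word_act w h m)"
    "word_act w (\<lambda>m. c * f m) = (\<lambda>m. c * word_act w f m)"
    by (simp_all add: word_act_def)
qed

lemma word_act_zero: "word_act w (\<lambda>m. 0) = (\<lambda>m. 0)"
  using word_act_linear(2)[of w 0 "\<lambda>m. 0"] by simp

lemma word_act_empty: "word_act 0 f = f"
  by (simp add: word_act_def zero_free_monoid_def)

lemma word_act_plus: "word_act (u + v) f = word_act u (word_act v f)"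
  by (simp add: word_act_def plus_free_monoid_def)

lemma fa_act_add: "fa_act (a + b) f = (\<lambda>m. fa_act a f m + fa_act b f m)"
proof
  fix m
  have fin: "finite {w. Poly_Mapping.lookup p w * word_act w f m \<noteq> 0}"
    for p
    by (rule finite_subset[OF _ finite_lookup[of p]]) auto
  show "fa_act (a + b) f m = fa_act a f m + fa_act b f m"
    unfolding fa_act_def lookup_add distrib_right by (rule Sum_any.distrib[OF fin fin])
qed

lemma fa_act_single: "fa_act (Poly_Mapping.single w c) f = (\<lambda>m. c * word_act w f m)"
proof
  fix m
  have "(\<Sum>v. Poly_Mapping.lookup (Poly_Mapping.single w c) v * word_act v f m) =
      (\<Sum>v\<in>{w}. Poly_Mapping.lookup (Poly_Mapping.single w c) v * word_act v f m)"
    by (rule Sum_any.expand_superset) (auto simp: lookup_single when_def)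
  then show "fa_act (Poly_Mapping.single w c) f m = c * word_act w f m"
    by (simp add: fa_act_def)
qed

lemma fa_act_zero: "fa_act 0 f = (\<lambda>m. 0)"
  using fa_act_single[of 0 0 f] by simp

lemma fa_act_one: "fa_act 1 f = f"
  using fa_act_single[of 0 1 f] by (simp add: word_act_empty)

lemma poly_mapping_sum_induct:
  fixes p :: "'a \<Rightarrow>\<^sub>0 'b::comm_monoid_add"
  assumes "P 0" and "\<And>w c. P (Poly_Mapping.single w c)"
    and "\<And>a b. P a \<Longrightarrow> P b \<Longrightarrow> P (a + b)"
  shows "P p"
proof (induction p rule: update_induct)
  case const
  then show ?case using assms(1) by simp
next
  case (update p w c)
  have "Poly_Mapping.update w c p = p + Poly_Mapping.single w c"
    using update(1)
    by (intro poly_mapping_eqI)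
      (auto simp: lookup_update lookup_add lookup_single when_def in_keys_iff)
  then show ?case using update assms by simp
qed

lemma fa_act_linear:
  "fa_act a (\<lambda>m. f m + h m) = (\<lambda>m. fa_act a f m + fa_act a h m)"
  "fa_act a (\<lambda>m. c * f m) = (\<lambda>m. c * fa_act a f m)"
  by (induction a rule: poly_mapping_sum_induct)
    (simp_all add: fa_act_zero fa_act_single fa_act_add word_act_linear algebra_simps)

lemma fa_act_mult: "fa_act (a * b) f = fa_act a (fa_act b f)"
proof (induction a rule: poly_mapping_sum_induct)
  case 2: (2 u c)
  show ?case
  proof (induction b rule: poly_mapping_sum_induct)
    case 1
    then show ?case by (simp add: fa_act_zero fa_act_single word_act_zero)
  qed (simp_all add: distrib_left fa_act_add fa_act_linear mult_single fa_act_single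
      word_act_plus word_act_linear mult_ac)
qed (simp_all add: fa_act_zero fa_act_add distrib_right)

lemma fa_act_uminus: "fa_act (- a) f = (\<lambda>m. - fa_act a f m)"
proof -
  have "(\<lambda>m. fa_act (- a) f m + fa_act a f m) = (\<lambda>m. 0)"
    using fa_act_add[of "- a" a f] by (simp add: fa_act_zero)
  then show ?thesis by (metis eq_neg_iff_add_eq_0)
qed

lemma fa_act_diff: "fa_act (a - b) f = (\<lambda>m. fa_act a f m - fa_act b f m)"
  using fa_act_add[of a "- b" f] by (simp add: fa_act_uminus)

lemma fa_act_gen: "fa_act (fa_gen g) f = gen_act g f"
  by (simp add: fa_gen_def fa_act_single word_act_def)

lemma fa_act_relator:
  assumes "r \<in> weyl_relators"
  shows "fa_act r f = (\<lambda>m. 0)"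
  using assms
proof cases
  case (xx i j)
  then show ?thesis
    by (auto simp: fun_eq_iff fa_act_diff fa_act_mult fa_act_gen fun_upd_twist)
next
  case (yy i j)
  then show ?thesis
    by (cases "i = j") (auto simp: fun_eq_iff fa_act_diff fa_act_mult fa_act_gen fa_act_zero fun_upd_twist)
next
  case (yx i j)
  show ?thesis
    unfolding yx
    by (cases "i = j")
      (auto simp: fun_eq_iff fa_act_diff fa_act_mult fa_act_add fa_act_gen fa_act_one fa_act_zero
        fun_upd_twist algebra_simps of_nat_diff)
qed

lemma fa_act_ideal: "a \<in> two_sided_ideal weyl_relators \<Longrightarrow> fa_act a f = (\<lambda>m. 0)"
proof (induction arbitrary: f rule: two_sided_ideal.induct)
  case (mult_left a c)
  then show ?case using fa_act_linear(2)[of c 0 "\<lambda>m. 0"] by (simp add: fa_act_mult)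
qed (simp_all add: fa_act_zero fa_act_relator fa_act_add fa_act_mult)

lemma one_not_in_weyl_ideal:
  "(1 :: ('k::field, 'n weyl_gen) free_algebra) \<notin> two_sided_ideal weyl_relators"
proof
  assume "(1 :: ('k, 'n weyl_gen) free_algebra) \<in> two_sided_ideal weyl_relators"
  from fa_act_ideal[OF this, of "\<lambda>m. 1"] show False
    by (simp add: fa_act_one fun_eq_iff)
qed

quotient_type (overloaded) ('k, 'n) weyl = "('k::field, 'n weyl_gen) free_algebra" / weyl_cong
  by (rule equivp_weyl_cong)

instantiation weyl :: (field, type) ring_1
begin

lift_definition zero_weyl :: "('a, 'b) weyl" is 0 .

lift_definition one_weyl :: "('a, 'b) weyl" is 1 .

lift_definition plus_weyl :: "('a, 'b) weyl \<Rightarrow> ('a, 'b) weyl \<Rightarrow> ('a, 'b) weyl" is "(+)"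
  unfolding weyl_cong_def by (metis add_diff_add two_sided_ideal.add)

lift_definition minus_weyl :: "('a, 'b) weyl \<Rightarrow> ('a, 'b) weyl \<Rightarrow> ('a, 'b) weyl" is "(-)"
  unfolding weyl_cong_def
proof -
  fix a a' b b' :: "('a, 'b weyl_gen) free_algebra"
  assume "a - a' \<in> two_sided_ideal weyl_relators" "b - b' \<in> two_sided_ideal weyl_relators"
  from two_sided_ideal_diff[OF this] show "a - b - (a' - b') \<in> two_sided_ideal weyl_relators"
    by (simp add: algebra_simps)
qed

lift_definition uminus_weyl :: "('a, 'b) weyl \<Rightarrow> ('a, 'b) weyl" is uminus
  unfolding weyl_cong_def by (metis minus_diff_minus two_sided_ideal_uminus)

lift_definition times_weyl :: "('a, 'b) weyl \<Rightarrow> ('a, 'b) weyl \<Rightarrow> ('a, 'b) weyl" is "(*)"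
proof -
  fix a a' b b' :: "('a, 'b weyl_gen) free_algebra"
  assume "weyl_cong a a'" "weyl_cong b b'"
  then have "(a - a') * b + a' * (b - b') \<in> two_sided_ideal weyl_relators"
    unfolding weyl_cong_def
    by (intro two_sided_ideal.add two_sided_ideal.mult_left two_sided_ideal.mult_right)
  then show "weyl_cong (a * b) (a' * b')"
    by (simp add: weyl_cong_def algebra_simps)
qed

instance
proof
  show "(0 :: ('a, 'b) weyl) \<noteq> 1"
  proof (transfer, unfold weyl_cong_def, rule notI)
    assume "(0 :: ('a, 'b weyl_gen) free_algebra) - 1 \<in> two_sided_ideal weyl_relators"
    from two_sided_ideal_uminus[OF this] show False
      by (simp add: one_not_in_weyl_ideal)
  qed
qed (transfer; simp add: weyl_cong_def two_sided_ideal.zero algebra_simps)+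

end

lift_definition weyl_const :: "'k::field \<Rightarrow> ('k, 'n) weyl" is fa_const .

lift_definition weyl_x :: "'n \<Rightarrow> ('k::field, 'n) weyl" is "\<lambda>i. fa_gen (GenX i)" .

lift_definition weyl_y :: "'n \<Rightarrow> ('k::field, 'n) weyl" is "\<lambda>i. fa_gen (GenY i)" .

lemma weyl_relations:
  fixes i j :: 'n
  shows "weyl_x i * weyl_x j = (weyl_x j * weyl_x i :: ('k::field, 'n) weyl)"
    and "weyl_y i * weyl_y j = (weyl_y j * weyl_y i :: ('k, 'n) weyl)"
    and "weyl_y i * weyl_x j - weyl_x j * weyl_y i = (if i = j then 1 else 0 :: ('k, 'n) weyl)"
proof -
  note abs_eqs = weyl_x.abs_eq weyl_y.abs_eq times_weyl.abs_eq minus_weyl.abs_eq one_weyl.abs_eq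
    zero_weyl.abs_eq weyl.abs_eq_iff weyl_cong_def
  show "weyl_x i * weyl_x j = (weyl_x j * weyl_x i :: ('k, 'n) weyl)"
    "weyl_y i * weyl_y j = (weyl_y j * weyl_y i :: ('k, 'n) weyl)"
    by (simp_all add: abs_eqs two_sided_ideal.incl weyl_relators.intros)
  show "weyl_y i * weyl_x j - weyl_x j * weyl_y i = (if i = j then 1 else 0 :: ('k, 'n) weyl)"
    using two_sided_ideal.incl[OF weyl_relators.yx[of i j]]
    by (cases "i = j") (simp_all add: abs_eqs)
qed


text \<open>
  \<open>D\<close>, together with \<open>\<iota> : A \<rightarrow> D\<close>, is the division ring of fractions of \<open>A\<close>: \<open>\<iota>\<close> is an
  embedding of rings and every element of \<open>D\<close> is a fraction \<open>\<iota> a * (\<iota> b)\<^sup>-\<^sup>1\<close>. If such a pair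
  exists, \<open>A\<close> is a right Ore domain and the pair is unique up to a unique isomorphism over \<open>A\<close>.
\<close>

definition division_ring_of_fractions :: "('a::ring_1 \<Rightarrow> 'd::division_ring) \<Rightarrow> bool"
  where "division_ring_of_fractions \<iota> \<longleftrightarrow>
    \<iota> 1 = 1 \<and> (\<forall>a b. \<iota> (a + b) = \<iota> a + \<iota> b) \<and> (\<forall>a b. \<iota> (a * b) = \<iota> a * \<iota> b) \<and> inj \<iota> \<and>
    (\<forall>d. \<exists>a b. b \<noteq> 0 \<and> d = \<iota> a * inverse (\<iota> b))"

definition center :: "'d::ring_1 set"
  where "center = {z. \<forall>d. z * d = d * z}"

inductive_set subring_generated :: "'d::ring_1 set \<Rightarrow> 'd set" for S :: "'d set" where
  one: "1 \<in> subring_generated S"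
| incl: "a \<in> S \<Longrightarrow> a \<in> subring_generated S"
| diff: "a \<in> subring_generated S \<Longrightarrow> b \<in> subring_generated S \<Longrightarrow> a - b \<in> subring_generated S"
| mult: "a \<in> subring_generated S \<Longrightarrow> b \<in> subring_generated S \<Longrightarrow> a * b \<in> subring_generated S"

text \<open>In both definitions, \<open>F\<close> is meant to be a central subfield.\<close>

definition affine_over :: "'d::ring_1 set \<Rightarrow> bool"
  where "affine_over F \<longleftrightarrow> (\<exists>S. finite S \<and> subring_generated (F \<union> S) = UNIV)"

definition finite_dimensional_over :: "'d::ring_1 set \<Rightarrow> bool"
  where "finite_dimensional_over F \<longleftrightarrow>
    (\<exists>B. finite B \<and> (\<forall>d. \<exists>c. (\<forall>b\<in>B. c b \<in> F) \<and> d = (\<Sum>b\<in>B. c b * b)))"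

end

theory Submission
  imports Defs "HOL-Library.Countable"
begin

text \<open>
  Write \<open>A\<close> for the Weyl algebra and \<open>D\<close> for its division ring of fractions, and filter \<open>A\<close> by
  the order in the \<open>y\<close>-variables. The associated graded ring is the commutative polynomial ring
  \<open>k[X, Y]\<close>, over every field. In characteristic 0 this is read off from differential operators;
  in general it comes from the action of \<open>A\<close> on \<open>k[X, Y]\<close> in which \<open>x\<^sub>i\<close> is multiplication by \<open>X\<^sub>i\<close>
  and \<open>y\<^sub>i\<close> is \<open>Y\<^sub>i + \<partial>/\<partial>X\<^sub>i\<close>: the map \<open>a \<mapsto> a\<cdot>1\<close> takes \<open>x\<^sup>\<alpha> y\<^sup>\<beta>\<close> to \<open>X\<^sup>\<alpha> Y\<^sup>\<beta>\<close>, normal ordering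
  inverts it (\<open>normal_order_symbol\<close>), and it is multiplicative up to terms of lower order
  (\<open>symbol_mult_below\<close>).

  The order of a fraction \<open>a b\<^sup>-\<^sup>1\<close> is the difference of the orders. Finitely many elements of \<open>D\<close>
  have a common denominator \<open>b\<close>, so a finitely generated algebra lies in the ring generated by \<open>A\<close>
  and \<open>b\<^sup>-\<^sup>1\<close>. Moving \<open>b\<^sup>-\<^sup>1\<close> past an element of \<open>A\<close> costs a commutator, which has lower order; by
  iteration, every element of that ring agrees with some \<open>a b\<^sup>-\<^sup>m\<close> up to terms of arbitrarily low
  order (\<open>subring_generated_approximable\<close>). Applied to an inverse \<open>g\<^sup>-\<^sup>1\<close>, this says that the
  principal symbol of \<open>g\<close> divides a power of the principal symbol \<open>f\<close> of \<open>b\<close>. This fails for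
  \<open>g = y\<^sub>i\<^sup>d + x\<^sub>i b\<close>, where \<open>d\<close> is the order of \<open>b\<close>: its principal symbol is \<open>P = Y\<^sub>i\<^sup>d + X\<^sub>i f\<close>, and if
  \<open>P\<close> divided a power of \<open>f\<close>, then by \<open>Y\<^sub>i\<^sup>d \<equiv> - X\<^sub>i f\<close> modulo \<open>P\<close> it would divide
  a power of \<open>Y\<^sub>i\<^sup>d\<close>, although it has
  positive degree in \<open>X\<^sub>i\<close> (\<open>exists_nondivisor\<close>). Hence \<open>D\<close> is never finitely generated over \<open>k\<close>,
  nor even over \<open>A\<close>.

  In characteristic 0 the algebra \<open>A\<close> is simple with center \<open>k\<close>, because commutators with the
  generators are partial derivatives of symbols; so the center of \<open>D\<close> is \<open>k\<close>
  (\<open>center_subset_const\<close>), and \<open>D\<close> is not affine over it. In characteristic \<open>p\<close> all \<open>x\<^sub>i\<^sup>p\<close> and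
  \<open>y\<^sub>i\<^sup>p\<close> are central, so \<open>A\<close> lies in the span over the center of \<open>D\<close> of the finitely many
  monomials with exponents below \<open>p\<close>. That span contains the inverses of the nonzero elements of
  \<open>A\<close>, since multiplication by such an element is injective on it, hence surjective. So it is \<open>D\<close>
  (\<open>finite_dimensional_if_char_pos\<close>).
\<close>

section \<open>Common denominators in a division ring of fractions\<close>

context
  fixes \<iota> :: "'a::ring_1 \<Rightarrow> 'd::division_ring"
  assumes frac: "division_ring_of_fractions \<iota>"
begin

lemma frac_one: "\<iota> 1 = 1"
  and frac_add: "\<iota> (a + b) = \<iota> a + \<iota> b"
  and frac_mult: "\<iota> (a * b) = \<iota> a * \<iota> b"
  and frac_eq_iff: "\<iota> a = \<iota> b \<longleftrightarrow> a = b"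
  and frac_exhaust: "\<exists>a b. b \<noteq> 0 \<and> d = \<iota> a * inverse (\<iota> b)"
  using frac unfolding division_ring_of_fractions_def inj_def by auto

lemma frac_zero: "\<iota> 0 = 0"
  using frac_add[of 0 0] by simp

lemma frac_diff: "\<iota> (a - b) = \<iota> a - \<iota> b"
  using frac_add[of "a - b" b] by (simp add: algebra_simps)

lemma frac_eq_0_iff: "\<iota> a = 0 \<longleftrightarrow> a = 0"
  using frac_eq_iff[of a 0] by (simp add: frac_zero)

lemma frac_power: "\<iota> (a ^ m) = \<iota> a ^ m"
  by (induction m) (simp_all add: frac_one frac_mult)

lemma frac_mult_eq_0_iff: "(a::'a) * b = 0 \<longleftrightarrow> a = 0 \<or> b = 0"
  by (metis frac_eq_0_iff frac_mult mult_eq_0_iff)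

lemma frac_power_eq_0_iff: "(a::'a) ^ m = 0 \<longleftrightarrow> a = 0 \<and> m > 0"
  by (induction m) (auto simp: frac_mult_eq_0_iff)

text \<open>
  The Ore condition is a consequence of the existence of \<open>D\<close>: rewrite the left fraction \<open>b\<^sup>-\<^sup>1 a\<close> as a right fraction
  \<open>a' b'\<^sup>-\<^sup>1\<close>, which is possible since every element is one, and clear
  denominators.
\<close>

lemma right_Ore:
  assumes "b \<noteq> 0"
  shows "\<exists>a' b'. b' \<noteq> 0 \<and> a * b' = b * a' \<and> inverse (\<iota> b) * \<iota> a = \<iota> a' * inverse (\<iota> b')"
proof -
  obtain a' b' where b': "b' \<noteq> 0" and eq: "inverse (\<iota> b) * \<iota> a = \<iota> a' * inverse (\<iota> b')"
    using frac_exhaust by blast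
  have "\<iota> b * (inverse (\<iota> b) * \<iota> a) * \<iota> b' = \<iota> b * (\<iota> a' * inverse (\<iota> b')) * \<iota> b'"
    by (simp add: eq)
  then have "\<iota> (a * b') = \<iota> (b * a')"
    using assms b' by (simp add: frac_mult frac_eq_0_iff mult.assoc[symmetric])
      (simp add: mult.assoc frac_eq_0_iff)
  with b' eq show ?thesis by (auto simp: frac_eq_iff)
qed

lemma frac_expand:
  assumes "b \<noteq> 0" "u \<noteq> 0"
  shows "\<iota> a * inverse (\<iota> b) = \<iota> (a * u) * inverse (\<iota> (b * u))"
proof -
  have "\<iota> (a * u) * inverse (\<iota> (b * u)) = \<iota> a * (\<iota> u * inverse (\<iota> u)) * inverse (\<iota> b)"
    using assms by (simp only: frac_mult nonzero_inverse_mult_distrib frac_eq_0_iff mult.assoc not_False_eq_True)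
  then show ?thesis using assms by (simp add: frac_eq_0_iff)
qed

lemma common_denominator:
  assumes "finite S"
  shows "\<exists>b. b \<noteq> 0 \<and> (\<forall>s\<in>S. \<exists>a. s = \<iota> a * inverse (\<iota> b))"
  using assms
proof (induction S rule: finite_induct)
  case empty
  show ?case by (intro exI[of _ 1]) auto
next
  case (insert d S)
  then obtain b where b: "b \<noteq> 0" "\<forall>s\<in>S. \<exists>a. s = \<iota> a * inverse (\<iota> b)" by blast
  obtain a c where c: "c \<noteq> 0" "d = \<iota> a * inverse (\<iota> c)" using frac_exhaust by blast
  obtain u v where u: "u \<noteq> 0" "b * u = c * v" using right_Ore[OF c(1), of b] by blast
  have v: "v \<noteq> 0" using u b(1) by (metis frac_mult_eq_0_iff mult_zero_right)
  have "\<forall>s\<in>insert d S. \<exists>a. s = \<iota> a * inverse (\<iota> (b * u))"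
    using b u c v frac_expand by (metis insert_iff)
  then show ?case using b(1) u(1) frac_mult_eq_0_iff by blast
qed

end


section \<open>Subrings with a bounded denominator in a filtered division ring of fractions\<close>

text \<open>
  A filtration of \<open>A\<close> by natural numbers whose associated graded ring is a commutative domain.
\<close>

locale filtered_fractions =
  fixes \<iota> :: "'a::ring_1 \<Rightarrow> 'd::division_ring" and deg :: "'a \<Rightarrow> nat"
  assumes frac: "division_ring_of_fractions \<iota>"
    and deg_mult: "a \<noteq> 0 \<Longrightarrow> b \<noteq> 0 \<Longrightarrow> deg (a * b) = deg a + deg b"
    and deg_diff: "deg (a - b) \<le> max (deg a) (deg b)"
    and deg_commutator: "a * b \<noteq> b * a \<Longrightarrow> deg (a * b - b * a) < deg a + deg b"
begin

lemmas hom_simps = frac_one[OF frac] frac_mult[OF frac] frac_zero[OF frac]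
  frac_diff[OF frac] frac_eq_0_iff[OF frac] frac_power[OF frac]

lemmas dom_simps = frac_mult_eq_0_iff[OF frac] frac_power_eq_0_iff[OF frac]

text \<open>
  The filtration extended to \<open>D\<close>, with integral indices. One suitable
  presentation of \<open>d\<close> as a fraction is asked for; on \<open>A\<close> this gives back the filtration of \<open>A\<close>
  (\<open>order_le_hom\<close>, \<open>order_le_homD\<close>).
\<close>

definition order_le :: "'d \<Rightarrow> int \<Rightarrow> bool"
  where "order_le d n \<longleftrightarrow>
    (\<exists>a b. b \<noteq> 0 \<and> d = \<iota> a * inverse (\<iota> b) \<and> (a \<noteq> 0 \<longrightarrow> int (deg a) \<le> int (deg b) + n))"

lemma deg_one: "deg 1 = 0"
  using deg_mult[of 1 1] by simp

lemma order_le_exists: "\<exists>n. order_le d n"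
proof -
  obtain a b where "b \<noteq> 0" "d = \<iota> a * inverse (\<iota> b)" using frac_exhaust[OF frac] by blast
  then have "order_le d (int (deg a))" unfolding order_le_def by force
  then show ?thesis by blast
qed

lemma order_le_mono: "order_le d n \<Longrightarrow> n \<le> m \<Longrightarrow> order_le d m"
  unfolding order_le_def by (elim exE conjE, intro exI conjI, assumption+) auto

lemma order_le_zero: "order_le 0 n"
  unfolding order_le_def by (intro exI[of _ 0] exI[of _ 1]) (auto simp: hom_simps)

lemma order_le_hom: "(a \<noteq> 0 \<Longrightarrow> int (deg a) \<le> n) \<Longrightarrow> order_le (\<iota> a) n"
  unfolding order_le_def by (intro exI[of _ a] exI[of _ 1]) (auto simp: hom_simps deg_one)

lemma order_le_inverse:
  assumes "b \<noteq> 0"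
  shows "order_le (inverse (\<iota> b)) (- int (deg b))"
  unfolding order_le_def using assms by (intro exI[of _ 1] exI[of _ b]) (auto simp: hom_simps deg_one)

lemma order_le_homD:
  assumes "order_le (\<iota> c) n" "c \<noteq> 0"
  shows "int (deg c) \<le> n"
proof -
  obtain a b where b: "b \<noteq> 0" "\<iota> c = \<iota> a * inverse (\<iota> b)"
    and d: "a \<noteq> 0 \<longrightarrow> int (deg a) \<le> int (deg b) + n"
    using assms(1) unfolding order_le_def by blast
  have "\<iota> (c * b) = \<iota> a"
    using b by (simp add: hom_simps mult.assoc)
  then have "c * b = a" by (simp add: frac_eq_iff[OF frac])
  then have "a \<noteq> 0" "deg a = deg c + deg b"
    using assms b deg_mult dom_simps by auto
  with d show ?thesis by simp
qed

lemma order_le_diff: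
  assumes "order_le d n" "order_le e n"
  shows "order_le (d - e) n"
proof -
  obtain a b where b: "b \<noteq> 0" "d = \<iota> a * inverse (\<iota> b)"
    and d: "a \<noteq> 0 \<longrightarrow> int (deg a) \<le> int (deg b) + n"
    using assms(1) unfolding order_le_def by blast
  obtain a' b' where b': "b' \<noteq> 0" "e = \<iota> a' * inverse (\<iota> b')"
    and d': "a' \<noteq> 0 \<longrightarrow> int (deg a') \<le> int (deg b') + n"
    using assms(2) unfolding order_le_def by blast
  obtain u v where u: "u \<noteq> 0" "b * u = b' * v" using right_Ore[OF frac b'(1), of b] by blast
  have v: "v \<noteq> 0" using u b(1) by (metis dom_simps(1) mult_zero_right)
  have bu: "b * u \<noteq> 0" using b(1) u(1) by (simp add: dom_simps)
  have deg_bu: "deg (b * u) = deg b + deg u" "deg (b * u) = deg b' + deg v"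
    using deg_mult[OF b(1) u(1)] deg_mult[OF b'(1) v] by (simp_all add: u(2))
  have "d - e = \<iota> (a * u - a' * v) * inverse (\<iota> (b * u))"
    unfolding b(2) b'(2) frac_expand[OF frac b(1) u(1)] frac_expand[OF frac b'(1) v]
    by (simp only: frac_diff[OF frac] left_diff_distrib u(2))
  moreover have "int (deg (a * u - a' * v)) \<le> int (deg (b * u)) + n" if "a * u - a' * v \<noteq> 0"
  proof -
    have 1: "int (deg (a * u)) \<le> int (deg (b * u)) + n" if "a \<noteq> 0"
      using that u d deg_bu by (simp add: deg_mult)
    have 2: "int (deg (a' * v)) \<le> int (deg (b * u)) + n" if "a' \<noteq> 0"
      using that v d' deg_bu by (simp add: deg_mult)
    have 3: "deg 0 = 0" "deg (- x) \<le> deg x" for x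
      using deg_diff[of 0 x] deg_diff[of 1 1] deg_one by auto
    show ?thesis
      using 1 2 3(2)[of "a' * v"] deg_diff[of "a * u" "a' * v"] that
      by (cases "a = 0"; cases "a' = 0") (auto simp: max_def split: if_splits)
  qed
  ultimately show ?thesis using bu unfolding order_le_def by blast
qed

lemma order_le_add:
  assumes "order_le d n" "order_le e n"
  shows "order_le (d + e) n"
  using order_le_diff[OF assms(1) order_le_diff[OF order_le_zero assms(2)]] by simp

lemma order_le_mult:
  assumes "order_le d n" "order_le e m"
  shows "order_le (d * e) (n + m)"
proof -
  obtain a b where b: "b \<noteq> 0" "d = \<iota> a * inverse (\<iota> b)"
    and d: "a \<noteq> 0 \<longrightarrow> int (deg a) \<le> int (deg b) + n"
    using assms(1) unfolding order_le_def by blast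
  obtain a' b' where b': "b' \<noteq> 0" "e = \<iota> a' * inverse (\<iota> b')"
    and d': "a' \<noteq> 0 \<longrightarrow> int (deg a') \<le> int (deg b') + m"
    using assms(2) unfolding order_le_def by blast
  obtain c s where s: "s \<noteq> 0" "a' * s = b * c" "inverse (\<iota> b) * \<iota> a' = \<iota> c * inverse (\<iota> s)"
    using right_Ore[OF frac b(1), of a'] by blast
  have "d * e = \<iota> a * (inverse (\<iota> b) * \<iota> a') * inverse (\<iota> b')"
    by (simp add: b b' mult.assoc)
  also have "\<dots> = \<iota> (a * c) * inverse (\<iota> (b' * s))"
    using b'(1) s(1) by (simp add: s(3) hom_simps nonzero_inverse_mult_distrib mult.assoc)
  finally have eq: "d * e = \<iota> (a * c) * inverse (\<iota> (b' * s))" .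
  have "int (deg (a * c)) \<le> int (deg (b' * s)) + (n + m)" if "a * c \<noteq> 0"
  proof -
    from that have a: "a \<noteq> 0" and c: "c \<noteq> 0" by auto
    have a': "a' \<noteq> 0" using s(2) b(1) c by (metis dom_simps(1) mult_zero_left)
    have "deg a' + deg s = deg b + deg c"
      using arg_cong[OF s(2), of deg] a' s(1) b(1) c by (simp add: deg_mult)
    then show ?thesis using d d' a a' c b' s(1) by (simp add: deg_mult)
  qed
  with eq b' s(1) show ?thesis unfolding order_le_def by (metis dom_simps(1))
qed

context
  fixes b :: 'a
  assumes b_nz: "b \<noteq> 0"
begin

text \<open>
  The limits of fractions with denominator a power of \<open>b\<close>, for the topology on \<open>D\<close> given by the
  filtration. This is a ring, although the fractions \<open>a b\<^sup>-\<^sup>m\<close> themselves in general do not form one.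
\<close>

definition approximable :: "'d set"
  where "approximable = {d. \<forall>n. \<exists>a m. order_le (d - \<iota> a * inverse (\<iota> b) ^ m) n}"

lemma denominator_shift:
  "\<iota> a * inverse (\<iota> b) ^ m = \<iota> (a * b ^ j) * inverse (\<iota> b) ^ (m + j)"
proof -
  have "\<iota> b ^ j * inverse (\<iota> b) ^ (m + j) = inverse (\<iota> b) ^ m"
  proof (induction j)
    case (Suc j)
    have "\<iota> b ^ Suc j * inverse (\<iota> b) ^ (m + Suc j)
        = \<iota> b ^ j * (\<iota> b * inverse (\<iota> b)) * inverse (\<iota> b) ^ (m + j)"
      by (simp only: power_Suc2 power_Suc add_Suc_right mult.assoc)
        (simp only: power_commutes mult.assoc[symmetric])
    then show ?case using Suc b_nz by (simp add: hom_simps)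
  qed simp
  then show ?thesis by (simp add: hom_simps mult.assoc)
qed

lemma approximable_diff:
  assumes "d \<in> approximable" "e \<in> approximable"
  shows "d - e \<in> approximable"
  unfolding approximable_def
proof (intro CollectI allI)
  fix n
  obtain a m a' m' where 1: "order_le (d - \<iota> a * inverse (\<iota> b) ^ m) n"
    and 2: "order_le (e - \<iota> a' * inverse (\<iota> b) ^ m') n"
    using assms unfolding approximable_def by blast
  have "order_le ((d - e) - (\<iota> a * inverse (\<iota> b) ^ m - \<iota> a' * inverse (\<iota> b) ^ m')) n"
    using order_le_diff[OF 1 2] by (simp add: algebra_simps)
  moreover have "\<iota> a * inverse (\<iota> b) ^ m - \<iota> a' * inverse (\<iota> b) ^ m'
      = \<iota> (a * b ^ m' - a' * b ^ m) * inverse (\<iota> b) ^ (m + m')"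
    using denominator_shift[of a m m'] denominator_shift[of a' m' m]
    by (simp only: frac_diff[OF frac] left_diff_distrib add.commute)
  ultimately show "\<exists>a m. order_le (d - e - \<iota> a * inverse (\<iota> b) ^ m) n" by (metis (no_types))
qed

lemma approximable_fraction: "\<iota> a * inverse (\<iota> b) ^ m \<in> approximable"
  unfolding approximable_def by (auto intro!: exI[of _ a] exI[of _ m] simp: order_le_zero)

lemma approximableI:
  assumes "\<And>n. \<exists>e\<in>approximable. order_le (d - e) n"
  shows "d \<in> approximable"
  unfolding approximable_def
proof (intro CollectI allI)
  fix n
  obtain e where e: "e \<in> approximable" "order_le (d - e) n" using assms by blast
  obtain a m where 1: "order_le (e - \<iota> a * inverse (\<iota> b) ^ m) n"
    using e(1) unfolding approximable_def by blast
  show "\<exists>a m. order_le (d - \<iota> a * inverse (\<iota> b) ^ m) n"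
    using order_le_add[OF e(2) 1] by auto
qed

text \<open>
  By \<open>b\<^sup>-\<^sup>1 a = a b\<^sup>-\<^sup>1 + b\<^sup>-\<^sup>1 [a, b] b\<^sup>-\<^sup>1\<close>, where \<open>[a, b]\<close> has smaller degree than \<open>a b\<close>: each use of the
  formula moves \<open>b\<^sup>-\<^sup>1\<close> to the right in the main term and lowers the order of the error term by one.
\<close>

lemma inverse_hom_approximation:
  "\<exists>c m. order_le (inverse (\<iota> b) * \<iota> a - \<iota> c * inverse (\<iota> b) ^ m) (int (deg a) - int (deg b) - int K)"
proof (induction K arbitrary: a)
  case 0
  have "order_le (inverse (\<iota> b) * \<iota> a) (- int (deg b) + int (deg a))"
    by (intro order_le_mult order_le_inverse b_nz order_le_hom) auto
  then show ?case by (intro exI[of _ 0] exI) (simp add: hom_simps)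
next
  case (Suc K)
  let ?i = "inverse (\<iota> b)"
  define a' where "a' = a * b - b * a"
  obtain c m where c: "order_le (?i * \<iota> a' - \<iota> c * ?i ^ m) (int (deg a') - int (deg b) - int K)"
    using Suc by blast
  have b': "\<iota> b * ?i = 1" "?i * \<iota> b = 1" using b_nz by (simp_all add: hom_simps)
  have "?i * \<iota> a' * ?i = ?i * \<iota> a * (\<iota> b * ?i) - (?i * \<iota> b) * \<iota> a * ?i"
    by (simp add: a'_def hom_simps algebra_simps)
  then have eq: "?i * \<iota> a = \<iota> a * ?i + ?i * \<iota> a' * ?i" by (simp add: b')
  have shift: "\<iota> a * ?i + \<iota> c * ?i ^ Suc m = \<iota> (a * b ^ m + c) * ?i ^ Suc m"
    using denominator_shift[of a 1 m] by (simp add: frac_add[OF frac] distrib_right)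
  show ?case
  proof (cases "a' = 0")
    case True
    then have "order_le (?i * \<iota> a - \<iota> a * ?i ^ 1) (int (deg a) - int (deg b) - int (Suc K))"
      using eq by (simp add: hom_simps order_le_zero)
    then show ?thesis by blast
  next
    case False
    then have "deg a' < deg a + deg b" unfolding a'_def by (intro deg_commutator) auto
    moreover have "order_le ((?i * \<iota> a' - \<iota> c * ?i ^ m) * ?i)
        ((int (deg a') - int (deg b) - int K) + (- int (deg b)))"
      by (intro order_le_mult c order_le_inverse b_nz)
    ultimately have "order_le ((?i * \<iota> a' - \<iota> c * ?i ^ m) * ?i) (int (deg a) - int (deg b) - int (Suc K))"
      by (elim order_le_mono) simp
    moreover have "(?i * \<iota> a' - \<iota> c * ?i ^ m) * ?i = ?i * \<iota> a - \<iota> (a * b ^ m + c) * ?i ^ Suc m"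
      by (simp only: shift[symmetric] eq) (simp only: power_Suc2 left_diff_distrib mult.assoc add_diff_cancel_left)
    ultimately show ?thesis by metis
  qed
qed

lemma approximable_inverse_hom: "inverse (\<iota> b) * \<iota> a \<in> approximable"
  unfolding approximable_def
proof (intro CollectI allI)
  fix n
  obtain c m where "order_le (inverse (\<iota> b) * \<iota> a - \<iota> c * inverse (\<iota> b) ^ m)
      (int (deg a) - int (deg b) - int (nat (int (deg a) - n)))"
    using inverse_hom_approximation by blast
  then have "order_le (inverse (\<iota> b) * \<iota> a - \<iota> c * inverse (\<iota> b) ^ m) n"
    by (rule order_le_mono) linarith
  then show "\<exists>a' m. order_le (inverse (\<iota> b) * \<iota> a - \<iota> a' * inverse (\<iota> b) ^ m) n" by blast
qed

lemma approximable_mult_inverse_right: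
  assumes "d \<in> approximable"
  shows "d * inverse (\<iota> b) ^ j \<in> approximable"
proof (rule approximableI)
  fix n
  obtain l where l: "order_le (inverse (\<iota> b) ^ j) l" using order_le_exists by blast
  obtain a m where "order_le (d - \<iota> a * inverse (\<iota> b) ^ m) (n - l)"
    using assms unfolding approximable_def by blast
  from order_le_mult[OF this l]
  have "order_le (d * inverse (\<iota> b) ^ j - \<iota> a * inverse (\<iota> b) ^ (m + j)) n"
    by (simp add: left_diff_distrib power_add mult.assoc)
  then show "\<exists>e\<in>approximable. order_le (d * inverse (\<iota> b) ^ j - e) n"
    using approximable_fraction by blast
qed

text \<open>
  Multiplication by \<open>c\<close> shifts orders by a bounded amount, and right factors \<open>b\<^sup>-\<^sup>j\<close> preserve
  approximability, so only the products of \<open>c\<close> with elements of \<open>A\<close> matter.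
\<close>

lemma approximable_mult_left:
  assumes "\<And>a. c * \<iota> a \<in> approximable" "d \<in> approximable"
  shows "c * d \<in> approximable"
proof (rule approximableI)
  fix n
  obtain l where l: "order_le c l" using order_le_exists by blast
  obtain a m where "order_le (d - \<iota> a * inverse (\<iota> b) ^ m) (n - l)"
    using assms unfolding approximable_def by blast
  from order_le_mult[OF l this]
  have "order_le (c * d - c * \<iota> a * inverse (\<iota> b) ^ m) n"
    by (simp add: right_diff_distrib mult.assoc)
  then show "\<exists>e\<in>approximable. order_le (c * d - e) n"
    using approximable_mult_inverse_right[OF assms(1)] by blast
qed

lemma approximable_mult:
  assumes "d \<in> approximable" "e \<in> approximable"
  shows "d * e \<in> approximable"
proof (rule approximableI)
  fix n
  \<comment> \<open>Left multiplication by \<open>A\<close> and by \<open>b\<^sup>-\<^sup>1\<close> preserves approximable elements, so only the error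
    term of an approximation of \<open>d\<close> has to be estimated.\<close>
  have hom: "\<iota> a * e' \<in> approximable" if "e' \<in> approximable" for a e'
  proof (rule approximable_mult_left[OF _ that])
    show "\<iota> a * \<iota> c \<in> approximable" for c
      using approximable_fraction[of "a * c" 0] by (simp add: frac_mult[OF frac])
  qed
  have inv: "inverse (\<iota> b) ^ m * e' \<in> approximable" if "e' \<in> approximable" for m e'
  proof (induction m)
    case (Suc m)
    show ?case
      using approximable_mult_left[OF approximable_inverse_hom Suc] by (simp add: mult.assoc)
  qed (simp add: that)
  obtain l where l: "order_le e l" using order_le_exists by blast
  obtain a m where "order_le (d - \<iota> a * inverse (\<iota> b) ^ m) (n - l)"
    using assms(1) unfolding approximable_def by blast
  from order_le_mult[OF this l]
  have "order_le (d * e - \<iota> a * (inverse (\<iota> b) ^ m * e)) n"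
    by (simp add: left_diff_distrib mult.assoc)
  then show "\<exists>f\<in>approximable. order_le (d * e - f) n"
    using hom inv assms(2) by blast
qed

lemma subring_generated_approximable:
  assumes "S \<subseteq> range \<iota> \<union> {\<iota> a * inverse (\<iota> b) |a. True}"
  shows "subring_generated S \<subseteq> approximable"
proof
  fix d
  assume "d \<in> subring_generated S"
  then show "d \<in> approximable"
  proof induction
    case one
    show ?case using approximable_fraction[of 1 0] by (simp add: hom_simps)
  next
    case (incl d)
    then show ?case
      using assms approximable_fraction[of _ 0] approximable_fraction[of _ 1] by fastforce
  qed (simp_all add: approximable_diff approximable_mult)
qed

text \<open>
  Clear denominators in \<open>g\<^sup>-\<^sup>1 \<approx> a b\<^sup>-\<^sup>m\<close>, with an error of order less than that of \<open>g\<^sup>-\<^sup>1\<close>: the leading terms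
  of \<open>b\<^sup>m\<close> and \<open>g a\<close> agree.
\<close>

lemma inverse_approximable_imp_divides_power:
  assumes "g \<noteq> 0" "inverse (\<iota> g) \<in> approximable"
  shows "\<exists>a m. b ^ m - g * a \<noteq> 0 \<longrightarrow> deg (b ^ m - g * a) < deg (b ^ m)"
proof -
  obtain a m where *: "order_le (inverse (\<iota> g) - \<iota> a * inverse (\<iota> b) ^ m) (- int (deg g) - 1)"
    using assms(2) unfolding approximable_def by blast
  have bm: "b ^ m \<noteq> 0" using b_nz by (simp add: dom_simps)
  have "order_le (\<iota> g * (inverse (\<iota> g) - \<iota> a * inverse (\<iota> b) ^ m) * \<iota> (b ^ m))
     ((int (deg g) + (- int (deg g) - 1)) + int (deg (b ^ m)))"
    by (intro order_le_mult * order_le_hom) auto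
  moreover have "inverse (\<iota> b) ^ m * \<iota> b ^ m = 1"
    using b_nz by (simp add: power_inverse hom_simps)
  then have "\<iota> g * (inverse (\<iota> g) - \<iota> a * inverse (\<iota> b) ^ m) * \<iota> (b ^ m) = \<iota> (b ^ m - g * a)"
    using assms(1) by (simp add: hom_simps algebra_simps)
  ultimately have "order_le (\<iota> (b ^ m - g * a)) (int (deg (b ^ m)) - 1)"
    by simp
  from order_le_homD[OF this] show ?thesis by force
qed

end

text \<open>
  For \<open>b\<close> a common denominator of \<open>S\<close>, the approximation of \<open>g\<^sup>-\<^sup>1\<close> by some \<open>a b\<^sup>-\<^sup>m\<close> would give
  \<open>b\<^sup>m = g a\<close> up to terms of lower degree. The hypothesis provides a \<open>g\<close> for which there is no such
  equation.
\<close>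

theorem not_finitely_generated:
  assumes "\<And>b. b \<noteq> 0 \<Longrightarrow> \<exists>g. g \<noteq> 0 \<and>
      (\<forall>a m. b ^ m - g * a \<noteq> 0 \<and> deg (b ^ m) \<le> deg (b ^ m - g * a))"
    and "finite S"
  shows "subring_generated (range \<iota> \<union> S) \<noteq> UNIV"
proof
  assume *: "subring_generated (range \<iota> \<union> S) = UNIV"
  obtain b where b: "b \<noteq> 0" "\<forall>s\<in>S. \<exists>a. s = \<iota> a * inverse (\<iota> b)"
    using common_denominator[OF frac assms(2)] by blast
  obtain g where g: "g \<noteq> 0" "\<forall>a m. b ^ m - g * a \<noteq> 0 \<and> deg (b ^ m) \<le> deg (b ^ m - g * a)"
    using assms(1)[OF b(1)] by blast
  have "subring_generated (range \<iota> \<union> S) \<subseteq> approximable b"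
    using b by (intro subring_generated_approximable) auto
  with * have "inverse (\<iota> g) \<in> approximable b" by blast
  from inverse_approximable_imp_divides_power[OF b(1) g(1) this] g(2) show False
    by (meson not_le)
qed

end

section \<open>Polynomials, partial derivatives and gradings\<close>

text \<open>
  Indexing the variables by natural numbers makes the exponents linearly ordered, hence the
  polynomials an integral domain.
\<close>

type_synonym 'k mpoly = "(nat \<Rightarrow>\<^sub>0 nat) \<Rightarrow>\<^sub>0 'k"

definition pvar :: "nat \<Rightarrow> 'k::comm_ring_1 mpoly"
  where "pvar v = Poly_Mapping.single (Poly_Mapping.single v 1) 1"

lemma pvar_nonzero: "pvar v \<noteq> (0 :: 'k::comm_ring_1 mpoly)"
proof
  assume "pvar v = (0 :: 'k mpoly)"
  from arg_cong[OF this, of "\<lambda>p. Poly_Mapping.lookup p (Poly_Mapping.single v 1)"]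
  show False by (simp add: pvar_def)
qed

definition pconst :: "'k::comm_ring_1 \<Rightarrow> 'k mpoly"
  where "pconst c = Poly_Mapping.single 0 c"

lift_definition pd :: "nat \<Rightarrow> 'k::comm_ring_1 mpoly \<Rightarrow> 'k mpoly" is
  "\<lambda>v p m. of_nat (Poly_Mapping.lookup m v + 1) * p (m + Poly_Mapping.single v 1)"
proof -
  fix v :: nat and p :: "(nat \<Rightarrow>\<^sub>0 nat) \<Rightarrow> 'k"
  assume fin: "finite {m. p m \<noteq> 0}"
  have "inj (\<lambda>m :: nat \<Rightarrow>\<^sub>0 nat. m + Poly_Mapping.single v 1)" by (simp add: inj_def)
  from finite_vimageI[OF fin this]
  show "finite {m. of_nat (Poly_Mapping.lookup m v + 1) * p (m + Poly_Mapping.single v 1) \<noteq> 0}"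
    by (rule rev_finite_subset) auto
qed

lemma exponent_decompose:
  assumes "Poly_Mapping.lookup m v \<noteq> 0"
  shows "\<exists>m' :: nat \<Rightarrow>\<^sub>0 nat. m = m' + Poly_Mapping.single v 1"
proof
  show "m = (m - Poly_Mapping.single v 1) + Poly_Mapping.single v 1"
    using assms by (intro poly_mapping_eqI) (auto simp: lookup_add lookup_minus lookup_single when_def)
qed

lemma lookup_pvar_mult:
  "Poly_Mapping.lookup (pvar v * p) (m + Poly_Mapping.single v 1) = Poly_Mapping.lookup p m"
  "Poly_Mapping.lookup m' v = 0 \<Longrightarrow> Poly_Mapping.lookup (pvar v * p) m' = 0"
proof -
  have "Poly_Mapping.lookup (pvar v * p) (m + Poly_Mapping.single v 1) = Poly_Mapping.lookup p m \<and>
    (Poly_Mapping.lookup m' v = 0 \<longrightarrow> Poly_Mapping.lookup (pvar v * p) m' = 0)"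
  proof (induction p rule: poly_mapping_sum_induct)
    case (2 w c)
    have "Poly_Mapping.single v 1 + w = m' \<Longrightarrow> Poly_Mapping.lookup m' v \<noteq> 0"
      by (auto simp: lookup_add)
    then show ?case
      by (auto simp: pvar_def mult_single lookup_single when_def add.commute)
  qed (simp_all add: distrib_left lookup_add)
  then show "Poly_Mapping.lookup (pvar v * p) (m + Poly_Mapping.single v 1) = Poly_Mapping.lookup p m"
    "Poly_Mapping.lookup m' v = 0 \<Longrightarrow> Poly_Mapping.lookup (pvar v * p) m' = 0" by auto
qed

lemma pd_add: "pd v (p + q) = pd v p + pd v q"
  by (intro poly_mapping_eqI) (simp add: pd.rep_eq lookup_add algebra_simps)

lemma pd_pconst_mult: "pd v (pconst c * q) = pconst c * pd v q"
proof -
  have "Poly_Mapping.lookup (pconst c * r) m = c * Poly_Mapping.lookup r m" for r m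
    by (induction r rule: poly_mapping_sum_induct)
      (auto simp: pconst_def mult_single lookup_add lookup_single when_def algebra_simps)
  then show ?thesis
    by (intro poly_mapping_eqI) (simp add: pd.rep_eq)
qed

lemma pd_commute: "pd u (pd v p) = pd v (pd u p)"
  by (cases "u = v", simp, intro poly_mapping_eqI)
    (simp add: pd.rep_eq lookup_add lookup_single add.commute add.left_commute mult.left_commute)

lemma pd_pvar_mult: "pd v (pvar u * q) = pvar u * pd v q + (if u = v then q else 0)"
proof (intro poly_mapping_eqI)
  fix m
  show "Poly_Mapping.lookup (pd v (pvar u * q)) m = Poly_Mapping.lookup (pvar u * pd v q + (if u = v then q else 0)) m"
  proof (cases "Poly_Mapping.lookup m u = 0")
    case True
    then show ?thesis
      using lookup_pvar_mult(1)[of u q m]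
      by (auto simp: pd.rep_eq lookup_pvar_mult(2) lookup_add lookup_single)
  next
    case False
    then obtain m' where m: "m = m' + Poly_Mapping.single u 1" using exponent_decompose by blast
    have swap: "m' + Poly_Mapping.single u 1 + Poly_Mapping.single v 1
        = (m' + Poly_Mapping.single v 1) + Poly_Mapping.single u 1" by (simp add: ac_simps)
    show ?thesis
      unfolding m pd.rep_eq lookup_add[of "pvar u * pd v q"] lookup_pvar_mult(1) swap
      by (auto simp: pd.rep_eq lookup_add lookup_single algebra_simps)
  qed
qed

lemma pd_pconst: "pd v (pconst c) = 0"
  by (intro poly_mapping_eqI)
    (auto simp: pd.rep_eq pconst_def lookup_single when_def poly_mapping_eq_iff fun_eq_iff lookup_add
      split: if_splits)

lemma pd_single:
  "pd v (Poly_Mapping.single m c) =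
    Poly_Mapping.single (m - Poly_Mapping.single v 1) (of_nat (Poly_Mapping.lookup m v) * c)"
proof (cases "Poly_Mapping.lookup m v = 0")
  case True
  have "m \<noteq> m' + Poly_Mapping.single v 1" for m'
    using True by (auto simp: lookup_add)
  then show ?thesis
    using True by (intro poly_mapping_eqI) (auto simp: pd.rep_eq lookup_single when_def)
next
  case False
  then obtain m' where m: "m = m' + Poly_Mapping.single v 1" using exponent_decompose by blast
  show ?thesis
    unfolding m by (intro poly_mapping_eqI) (auto simp: pd.rep_eq lookup_single when_def lookup_add)
qed

lemma pd_pvar_power: "u \<noteq> v \<Longrightarrow> pd v (pvar u ^ d) = 0"
proof (induction d)
  case 0
  show ?case using pd_pconst[of v 1] by (simp add: pconst_def)
qed (simp add: pd_pvar_mult)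

lemma pd_zero_imp_lookup_zero:
  fixes p :: "'k::{comm_ring_1, ring_no_zero_divisors} mpoly"
  assumes "pd v p = 0" "CHAR('k) = 0" "Poly_Mapping.lookup m v \<noteq> 0"
  shows "Poly_Mapping.lookup p m = 0"
proof -
  obtain m' where m: "m = m' + Poly_Mapping.single v 1"
    using exponent_decompose[OF assms(3)] by blast
  have "of_nat (Poly_Mapping.lookup m' v + 1) * Poly_Mapping.lookup p m = 0"
    using arg_cong[OF assms(1), of "\<lambda>q. Poly_Mapping.lookup q m'"] by (simp add: pd.rep_eq m)
  then show ?thesis
    using of_nat_eq_0_iff_char_dvd[where 'a = 'k, of "Poly_Mapping.lookup m' v + 1"] assms(2) by simp
qed

text \<open>
  The ring homomorphism \<open>p \<mapsto> \<Sum> p\<^sub>d t\<^sup>d\<close>, where \<open>p\<^sub>d\<close> is the component of \<open>p\<close> of weight \<open>d\<close>. It turns statements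
  on weighted degrees and top components into the known ones on \<open>degree\<close> and \<open>lead_coeff\<close>.
\<close>

definition graded :: "((nat \<Rightarrow>\<^sub>0 nat) \<Rightarrow> nat) \<Rightarrow> 'k::comm_ring_1 mpoly \<Rightarrow> 'k mpoly poly"
  where "graded w p = (\<Sum>m\<in>Poly_Mapping.keys p. monom (Poly_Mapping.single m (Poly_Mapping.lookup p m)) (w m))"

lemma graded_superset:
  assumes "finite A" "Poly_Mapping.keys p \<subseteq> A"
  shows "graded w p = (\<Sum>m\<in>A. monom (Poly_Mapping.single m (Poly_Mapping.lookup p m)) (w m))"
  unfolding graded_def
  by (rule sum.mono_neutral_left[OF assms]) (simp add: in_keys_iff)

lemma graded_add: "graded w (p + q) = graded w p + graded w q"
proof -
  have "Poly_Mapping.keys (p + q) \<subseteq> Poly_Mapping.keys p \<union> Poly_Mapping.keys q" by (rule keys_add)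
  then show ?thesis
    by (subst (1 2 3) graded_superset[of "Poly_Mapping.keys p \<union> Poly_Mapping.keys q"])
      (simp_all add: lookup_add single_add add_monom[symmetric] sum.distrib)
qed

lemma graded_single: "graded w (Poly_Mapping.single m c) = monom (Poly_Mapping.single m c) (w m)"
  by (subst graded_superset[of "{m}"]) auto

lemma graded_zero: "graded w 0 = 0"
  by (simp add: graded_def)

lemma graded_diff: "graded w (p - q) = graded w p - graded w q"
  using graded_add[of w "p - q" q] by (simp add: algebra_simps)

lemma poly_graded_one: "poly (graded w p) 1 = p"
  by (induction p rule: poly_mapping_sum_induct)
    (simp_all add: graded_zero graded_single graded_add poly_monom)

lemma graded_eq_0_iff: "graded w p = 0 \<longleftrightarrow> p = 0"
  using poly_graded_one[of w p] by (auto simp: graded_zero)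

lemma lookup_coeff_graded: "Poly_Mapping.lookup (coeff (graded w p) d) m = (if w m = d then Poly_Mapping.lookup p m else 0)"
  by (induction p rule: poly_mapping_sum_induct)
    (auto simp: graded_zero graded_single graded_add lookup_add lookup_single when_def)

context
  fixes w :: "(nat \<Rightarrow>\<^sub>0 nat) \<Rightarrow> nat"
  assumes w_add: "w (m + m') = w m + w m'"
begin

lemma graded_mult: "graded w (p * q) = graded w p * graded w q"
proof (induction p rule: poly_mapping_sum_induct)
  case 2: (2 u c)
  show ?case
    by (induction q rule: poly_mapping_sum_induct)
      (simp_all add: graded_zero graded_single graded_add distrib_left mult_single mult_monom w_add)
qed (simp_all add: graded_zero graded_add distrib_right)

lemma w_zero: "w 0 = 0"
  using w_add[of 0 0] by simp

lemma graded_pconst: "graded w (pconst c) = [:pconst c:]"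
  by (simp add: pconst_def graded_single w_zero monom_0)

lemma graded_one: "graded w 1 = 1"
  using graded_pconst[of 1] by (simp add: pconst_def one_pCons)

lemma graded_power: "graded w (p ^ n) = graded w p ^ n"
  by (induction n) (simp_all add: graded_one graded_mult)

lemma graded_pvar: "graded w (pvar v) = monom (pvar v) (w (Poly_Mapping.single v 1))"
  by (simp add: pvar_def graded_single)

lemma graded_pvar_power: "graded w (pvar v ^ d) = monom (pvar v ^ d) (d * w (Poly_Mapping.single v 1))"
  by (induction d) (simp_all add: graded_one graded_mult graded_pvar mult_monom)

end

text \<open>
  Stands for \<open>degree < d\<close>, with the degree of 0 understood as \<open>-\<infinity>\<close>; an error term that is below 0 vanishes.
\<close>

definition below :: "((nat \<Rightarrow>\<^sub>0 nat) \<Rightarrow> nat) \<Rightarrow> nat \<Rightarrow> 'k::comm_ring_1 mpoly \<Rightarrow> bool"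
  where "below w d p \<longleftrightarrow> (\<forall>m\<in>Poly_Mapping.keys p. w m < d)"

lemma below_iff_coeff: "below w d p \<longleftrightarrow> (\<forall>e\<ge>d. coeff (graded w p) e = 0)"
proof
  assume "below w d p"
  then show "\<forall>e\<ge>d. coeff (graded w p) e = 0"
    by (auto intro!: poly_mapping_eqI simp: lookup_coeff_graded below_def in_keys_iff
        simp flip: not_less)
next
  assume *: "\<forall>e\<ge>d. coeff (graded w p) e = 0"
  show "below w d p"
    unfolding below_def
  proof (rule ballI, rule ccontr)
    fix m assume "m \<in> Poly_Mapping.keys p" "\<not> w m < d"
    moreover from this(2) have "Poly_Mapping.lookup (coeff (graded w p) (w m)) m = 0" using * by simp
    ultimately show False by (simp add: lookup_coeff_graded in_keys_iff)
  qed
qed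

lemma below_Suc_iff: "below w (Suc d) p \<longleftrightarrow> degree (graded w p) \<le> d"
  unfolding below_iff_coeff Suc_le_eq
proof
  show "\<forall>e>d. coeff (graded w p) e = 0 \<Longrightarrow> degree (graded w p) \<le> d"
    by (rule degree_le)
qed (simp add: coeff_eq_0)

lemma below_0_iff: "below w 0 p \<longleftrightarrow> p = 0"
  by (simp add: below_def)

lemma below_zero: "below w d 0"
  by (simp add: below_def)

lemma below_add: "below w d p \<Longrightarrow> below w d q \<Longrightarrow> below w d (p + q)"
  by (simp add: below_iff_coeff graded_add)

lemma below_diff: "below w d p \<Longrightarrow> below w d q \<Longrightarrow> below w d (p - q)"
  by (simp add: below_iff_coeff graded_diff)

lemma below_mono: "below w d p \<Longrightarrow> d \<le> e \<Longrightarrow> below w e p"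
  by (force simp: below_def)

lemma below_degree: "p \<noteq> 0 \<Longrightarrow> below w d p \<longleftrightarrow> degree (graded w p) < d"
  by (cases d) (simp_all add: below_0_iff below_Suc_iff less_Suc_eq_le)

lemma below_mult:
  assumes "\<And>m m'. w (m + m') = w m + w m'" "below w (Suc d) p" "below w e q"
  shows "below w (d + e) (p * q)"
proof (cases e)
  case 0
  then show ?thesis using assms(3) by (simp add: below_0_iff below_zero)
next
  case (Suc e')
  then have "degree (graded w p) \<le> d" "degree (graded w q) \<le> e'"
    using assms(2,3) by (auto simp: below_Suc_iff)
  then have "degree (graded w p * graded w q) \<le> d + e'"
    using degree_mult_le[of "graded w p" "graded w q"] by linarith
  then show ?thesis by (simp add: Suc below_Suc_iff graded_mult[of w, OF assms(1)])
qed

lemma below_pd: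
  assumes "\<And>m m'. w (m + m') = w m + w m'" "below w d p"
  shows "below w (d - w (Poly_Mapping.single v 1)) (pd v p)"
  unfolding below_def
proof
  fix m
  assume "m \<in> Poly_Mapping.keys (pd v p)"
  then have "m + Poly_Mapping.single v 1 \<in> Poly_Mapping.keys p" by (auto simp: in_keys_iff pd.rep_eq)
  then have "w (m + Poly_Mapping.single v 1) < d" using assms(2) by (auto simp: below_def)
  then show "w m < d - w (Poly_Mapping.single v 1)" by (simp add: assms(1) less_diff_conv)
qed

text \<open>
  The role of \<open>r\<close> is played below by the symbol of a product in the Weyl algebra, which agrees with
  the product of the symbols up to terms of lower degree.
\<close>

lemma graded_top_coeff:
  fixes p q r :: "'k::idom mpoly"
  assumes w: "\<And>m m'. w (m + m') = w m + w m'"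
    and nz: "p \<noteq> 0" "q \<noteq> 0"
    and lower: "below w (degree (graded w p) + degree (graded w q)) (r - p * q)"
  shows "r \<noteq> 0" "degree (graded w r) = degree (graded w p) + degree (graded w q)"
    "lead_coeff (graded w r) = lead_coeff (graded w p) * lead_coeff (graded w q)"
proof -
  let ?n = "degree (graded w p) + degree (graded w q)"
  have eq: "coeff (graded w r) e = coeff (graded w p * graded w q) e" if "e \<ge> ?n" for e
    using lower that by (simp add: below_iff_coeff graded_diff graded_mult[of w, OF w])
  have top: "coeff (graded w r) ?n = lead_coeff (graded w p) * lead_coeff (graded w q)"
    by (simp add: eq coeff_mult_degree_sum)
  have ne: "coeff (graded w r) ?n \<noteq> 0"
    using nz by (simp add: top graded_eq_0_iff)
  have le: "degree (graded w r) \<le> ?n"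
    by (intro degree_le allI impI) (simp add: eq coeff_eq_0 le_less_trans[OF degree_mult_le])
  show "r \<noteq> 0" using ne by (auto simp: graded_zero)
  show "degree (graded w r) = ?n" using le le_degree[OF ne] by simp
  with top show "lead_coeff (graded w r) = lead_coeff (graded w p) * lead_coeff (graded w q)" by simp
qed

section \<open>The action of the Weyl algebra on polynomials\<close>

definition x_index :: "'n::finite \<Rightarrow> nat" where "x_index i = 2 * to_nat i"
definition y_index :: "'n::finite \<Rightarrow> nat" where "y_index i = 2 * to_nat i + 1"

lemma index_eq_iff [simp]:
  "x_index i = x_index j \<longleftrightarrow> i = j" "y_index i = y_index j \<longleftrightarrow> i = j"
  "x_index i \<noteq> y_index j" "y_index j \<noteq> x_index i"
  by (auto simp: x_index_def y_index_def) presburger+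

text \<open>
  The action on \<open>k[X]\<close> by differential operators is not faithful in positive characteristic, where
  \<open>(\<partial>/\<partial>X\<^sub>i)\<^sup>p = 0\<close>; adding the multiplication by \<open>Y\<^sub>i\<close> makes it faithful.
\<close>

fun gen_op :: "'n::finite weyl_gen \<Rightarrow> 'k::field mpoly \<Rightarrow> 'k mpoly" where
  "gen_op (GenX i) q = pvar (x_index i) * q"
| "gen_op (GenY i) q = pvar (y_index i) * q + pd (x_index i) q"

definition fa_op :: "('k::field, 'n::finite weyl_gen) free_algebra \<Rightarrow> 'k mpoly \<Rightarrow> 'k mpoly"
  where "fa_op a q = (\<Sum>u\<in>Poly_Mapping.keys a. pconst (Poly_Mapping.lookup a u) * foldr gen_op (letters u) q)"

lemma pconst_simps: "pconst 0 = 0" "pconst 1 = 1" "pconst (c + d) = pconst c + pconst d"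
    "pconst (c * d) = pconst c * pconst d"
  by (simp_all add: pconst_def single_add mult_single)

lemma pd_zero: "pd v 0 = 0"
  and pd_one: "pd v 1 = 0"
  using pd_pconst[of v 0] pd_pconst[of v 1] by (simp_all add: pconst_simps)

lemma gen_op_linear:
  "gen_op g (p + q) = gen_op g p + gen_op g q" "gen_op g (pconst c * q) = pconst c * gen_op g q"
  by (cases g; simp add: distrib_left pd_add pd_pconst_mult mult.left_commute add_ac)+

lemma foldr_gen_op_linear:
  "foldr gen_op xs (p + q) = foldr gen_op xs p + foldr gen_op xs q"
  "foldr gen_op xs (pconst c * q) = pconst c * foldr gen_op xs q"
  by (induction xs) (simp_all add: gen_op_linear)

lemma fa_op_superset:
  assumes "finite A" "Poly_Mapping.keys a \<subseteq> A"
  shows "fa_op a q = (\<Sum>u\<in>A. pconst (Poly_Mapping.lookup a u) * foldr gen_op (letters u) q)"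
  unfolding fa_op_def
  by (rule sum.mono_neutral_left[OF assms]) (simp add: in_keys_iff pconst_simps)

lemma fa_op_add: "fa_op (a + b) q = fa_op a q + fa_op b q"
  using keys_add[of a b]
  by (subst (1 2 3) fa_op_superset[of "Poly_Mapping.keys a \<union> Poly_Mapping.keys b"])
    (simp_all add: lookup_add pconst_simps distrib_right sum.distrib)

lemma fa_op_single: "fa_op (Poly_Mapping.single u c) q = pconst c * foldr gen_op (letters u) q"
  by (subst fa_op_superset[of "{u}"]) auto

lemma fa_op_zero: "fa_op 0 q = 0"
  by (simp add: fa_op_def)

lemma fa_op_diff: "fa_op (a - b) q = fa_op a q - fa_op b q"
  using fa_op_add[of "a - b" b q] by (simp add: algebra_simps)

lemma fa_op_one: "fa_op 1 q = q"
proof -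
  have "fa_op (Poly_Mapping.single 0 1) q = q"
    by (simp only: fa_op_single) (simp add: pconst_simps zero_free_monoid_def)
  then show ?thesis by simp
qed

lemma fa_op_gen: "fa_op (fa_gen g) q = gen_op g q"
  by (simp add: fa_gen_def fa_op_single pconst_simps)

lemma fa_op_linear:
  "fa_op a (p + q) = fa_op a p + fa_op a q" "fa_op a (pconst c * q) = pconst c * fa_op a q"
  by (induction a rule: poly_mapping_sum_induct)
    (simp_all add: fa_op_zero fa_op_single fa_op_add foldr_gen_op_linear distrib_left mult.left_commute add_ac)

lemma fa_op_zero_right: "fa_op a 0 = 0"
  using fa_op_linear(2)[of a 0 0] by (simp add: pconst_simps)

lemma fa_op_mult: "fa_op (a * b) q = fa_op a (fa_op b q)"
proof (induction a rule: poly_mapping_sum_induct)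
  case 2: (2 u c)
  show ?case
  proof (induction b rule: poly_mapping_sum_induct)
    case 1
    show ?case by (simp add: fa_op_zero fa_op_zero_right)
  next
    case (2 v d)
    show ?case
      by (simp add: mult_single fa_op_single foldr_gen_op_linear plus_free_monoid_def pconst_simps mult.assoc)
  qed (simp_all add: distrib_left fa_op_add fa_op_linear)
qed (simp_all add: fa_op_zero fa_op_add distrib_right)

lemma fa_op_relator:
  assumes "r \<in> weyl_relators"
  shows "fa_op r q = 0"
  using assms
proof cases
  case (xx i j)
  show ?thesis unfolding xx by (simp add: fa_op_diff fa_op_mult fa_op_gen mult.left_commute)
next
  case (yy i j)
  show ?thesis
    unfolding yy
    by (simp add: fa_op_diff fa_op_mult fa_op_gen pd_add pd_pvar_mult distrib_left mult.left_commute
        pd_commute[of "x_index i"])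
next
  case (yx i j)
  show ?thesis
    unfolding yx
    by (simp add: fa_op_diff fa_op_mult fa_op_gen fa_op_one fa_op_zero pd_pvar_mult distrib_left
        mult.left_commute)
qed

lemma fa_op_ideal: "a \<in> two_sided_ideal weyl_relators \<Longrightarrow> fa_op a q = 0"
  by (induction arbitrary: q rule: two_sided_ideal.induct)
    (simp_all add: fa_op_zero fa_op_relator fa_op_add fa_op_mult fa_op_zero_right)

lift_definition weyl_op :: "('k::field, 'n::finite) weyl \<Rightarrow> 'k mpoly \<Rightarrow> 'k mpoly" is fa_op
proof
  fix a b :: "('k, 'n weyl_gen) free_algebra" and q
  assume "weyl_cong a b"
  then show "fa_op a q = fa_op b q"
    unfolding weyl_cong_def using fa_op_ideal[of "a - b" q] by (simp add: fa_op_diff)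
qed

lemma weyl_const_simps:
  "weyl_const 0 = 0" "weyl_const 1 = 1"
  "weyl_const (c + d) = weyl_const c + weyl_const d" "weyl_const (c * d) = weyl_const c * weyl_const d"
proof -
  have eqI: "weyl_cong a b" if "a = b" for a b :: "('k::field, 'n weyl_gen) free_algebra"
    using that by (simp add: weyl_cong_def two_sided_ideal.zero)
  show "weyl_const 0 = 0" "weyl_const 1 = 1"
    "weyl_const (c + d) = weyl_const c + weyl_const d" "weyl_const (c * d) = weyl_const c * weyl_const d"
    by (transfer, rule eqI, simp add: fa_const_def single_add mult_single)+
qed

lemma weyl_const_central: "weyl_const c * a = a * weyl_const c"
proof -
  have "fa_const c * p = p * fa_const c" for p :: "('a, 'b weyl_gen) free_algebra"
    by (induction p rule: poly_mapping_sum_induct)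
      (simp_all add: fa_const_def mult_single distrib_left distrib_right mult.commute)
  then show ?thesis
    by transfer (simp add: weyl_cong_def two_sided_ideal.zero)
qed

lemma weyl_const_left_commute: "a * (weyl_const c * b) = weyl_const c * (a * b)"
  by (metis weyl_const_central mult.assoc)

lemma of_nat_weyl: "(of_nat m :: ('k::field, 'n) weyl) = weyl_const (of_nat m)"
  by (induction m) (simp_all add: weyl_const_simps)

text \<open>
  Every word in the generators is built from a constant by left multiplications with generators, and
  for these the action on polynomials is known.
\<close>

lemma weyl_induct [case_names const add x y]:
  fixes a :: "('k::field, 'n) weyl"
  assumes const: "\<And>c. P (weyl_const c)"
    and add: "\<And>a b. P a \<Longrightarrow> P b \<Longrightarrow> P (a + b)"
    and x: "\<And>i a. P a \<Longrightarrow> P (weyl_x i * a)"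
    and y: "\<And>i a. P a \<Longrightarrow> P (weyl_y i * a)"
  shows "P a"
proof -
  have "P (abs_weyl p)" for p
  proof (induction p rule: poly_mapping_sum_induct)
    case 1
    show ?case using const[of 0] by (simp add: weyl_const_simps zero_weyl.abs_eq)
  next
    case (2 u c)
    have "P (abs_weyl (Poly_Mapping.single (Word gs) c))" for gs
    proof (induction gs)
      case Nil
      show ?case using const[of c]
        by (simp add: weyl_const.abs_eq fa_const_def zero_free_monoid_def)
    next
      case (Cons g gs)
      have "Poly_Mapping.single (Word (g # gs)) c = fa_gen g * Poly_Mapping.single (Word gs) c"
        by (simp add: fa_gen_def mult_single plus_free_monoid_def)
      then show ?case
        using x[OF Cons] y[OF Cons]
        by (cases g) (simp_all add: weyl_x.abs_eq weyl_y.abs_eq times_weyl.abs_eq)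
    qed
    from this[of "letters u"] show ?case by simp
  next
    case (3 a b)
    then show ?case using add by (simp flip: plus_weyl.abs_eq)
  qed
  then show ?thesis by (rule weyl.abs_induct)
qed

lemma weyl_op_simps:
  "weyl_op 1 q = q" "weyl_op 0 q = 0"
  "weyl_op (a + b) q = weyl_op a q + weyl_op b q"
  "weyl_op (a - b) q = weyl_op a q - weyl_op b q"
  "weyl_op (a * b) q = weyl_op a (weyl_op b q)"
  "weyl_op (weyl_const c) q = pconst c * q"
  "weyl_op (weyl_x i) q = pvar (x_index i) * q"
  "weyl_op (weyl_y i) q = pvar (y_index i) * q + pd (x_index i) q"
proof -
  show "weyl_op (weyl_const c) q = pconst c * q"
    by transfer (simp add: fa_const_def fa_op_single zero_free_monoid_def)
  show "weyl_op 1 q = q" by transfer (rule fa_op_one)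
  show "weyl_op 0 q = 0" by transfer (rule fa_op_zero)
  show "weyl_op (a + b) q = weyl_op a q + weyl_op b q" by transfer (rule fa_op_add)
  show "weyl_op (a - b) q = weyl_op a q - weyl_op b q" by transfer (rule fa_op_diff)
  show "weyl_op (a * b) q = weyl_op a (weyl_op b q)" by transfer (rule fa_op_mult)
  show "weyl_op (weyl_x i) q = pvar (x_index i) * q" by transfer (simp add: fa_op_gen)
  show "weyl_op (weyl_y i) q = pvar (y_index i) * q + pd (x_index i) q"
    by transfer (simp add: fa_op_gen)
qed

text \<open>
  The full symbol: \<open>x\<^sup>\<alpha> y\<^sup>\<beta>\<close> is mapped to \<open>X\<^sup>\<alpha> Y\<^sup>\<beta>\<close>, as all derivatives of \<open>Y\<^sup>\<beta>\<close> with respect to the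
  \<open>X\<^sub>i\<close> vanish.
\<close>

definition symbol :: "('k::field, 'n::finite) weyl \<Rightarrow> 'k mpoly"
  where "symbol a = weyl_op a 1"

section \<open>Normal ordering\<close>

text \<open>
  The list fixes the order of the factors, which are taken from a noncommutative ring.
\<close>

definition power_prod :: "'n list \<Rightarrow> ('n \<Rightarrow> 'a::monoid_mult) \<Rightarrow> ('n \<Rightarrow> nat) \<Rightarrow> 'a"
  where "power_prod L g e = prod_list (map (\<lambda>i. g i ^ e i) L)"

lemma power_prod_simps:
  "power_prod [] g e = 1" "power_prod (i # L) g e = g i ^ e i * power_prod L g e"
  by (simp_all add: power_prod_def)

lemma power_prod_cong: "(\<And>i. i \<in> set L \<Longrightarrow> e i = e' i) \<Longrightarrow> power_prod L g e = power_prod L g e'"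
  unfolding power_prod_def by (intro arg_cong[where f = prod_list] map_cong) auto

lemma power_prod_zero: "power_prod L g (\<lambda>i. 0) = 1"
  by (induction L) (simp_all add: power_prod_simps)

lemma power_prod_raise:
  assumes comm: "\<And>i j. g i * g j = g j * (g i :: 'a::monoid_mult)"
    and "distinct L" "i \<in> set L"
  shows "g i ^ k * power_prod L g e = power_prod L g (e(i := e i + k))"
  using assms(2,3)
proof (induction L)
  case (Cons j L)
  show ?case
  proof (cases "i = j")
    case True
    then have eq: "power_prod L g e = power_prod L g (e(i := e i + k))"
      using Cons.prems by (intro power_prod_cong) auto
    have "g i ^ k * power_prod (j # L) g e = g i ^ (e i + k) * power_prod L g e"
      by (simp only: True power_prod_simps mult.assoc[symmetric] power_add[symmetric] add.commute)
    also have "\<dots> = power_prod (j # L) g (e(i := e i + k))"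
      unfolding eq by (simp only: True power_prod_simps fun_upd_same)
    finally show ?thesis .
  next
    case False
    have "g i ^ k * g j ^ l = g j ^ l * g i ^ k" for l
      using comm by (metis power_commuting_commutes)
    then have "g i ^ k * power_prod (j # L) g e = g j ^ e j * (g i ^ k * power_prod L g e)"
      by (simp add: power_prod_simps mult.assoc[symmetric])
    with False Cons show ?thesis by (simp add: power_prod_simps)
  qed
qed simp

definition index_list :: "'n::finite list"
  where "index_list = (SOME L. distinct L \<and> set L = UNIV)"

lemma index_list: "distinct (index_list :: 'n::finite list)" "set (index_list :: 'n list) = UNIV"
proof -
  have "\<exists>L :: 'n list. distinct L \<and> set L = UNIV"
    using finite_distinct_list[of "UNIV :: 'n set"] by auto
  from someI_ex[OF this] show "distinct (index_list :: 'n::finite list)" "set (index_list :: 'n list) = UNIV"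
    unfolding index_list_def by auto
qed

definition normal_mon :: "('n::finite \<Rightarrow> nat) \<Rightarrow> ('n \<Rightarrow> nat) \<Rightarrow> ('k::field, 'n) weyl"
  where "normal_mon \<alpha> \<beta> = power_prod index_list weyl_x \<alpha> * power_prod index_list weyl_y \<beta>"

lemma x_power_normal_mon: "weyl_x i ^ k * normal_mon \<alpha> \<beta> = normal_mon (\<alpha>(i := \<alpha> i + k)) \<beta>"
  unfolding normal_mon_def mult.assoc[symmetric]
  by (subst power_prod_raise) (simp_all add: index_list weyl_relations)

lemma of_nat_left_commute: "a * (of_nat m * b) = of_nat m * (a * (b :: 'a::semiring_1))"
  by (metis mult.assoc mult_of_nat_commute)

lemma y_mult_x_power:
  "weyl_y i * weyl_x j ^ m = (weyl_x j ^ m * weyl_y i + (if i = j then of_nat m * weyl_x j ^ (m - 1) else 0)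
    :: ('k::field, 'n) weyl)"
proof (induction m)
  case (Suc m)
  have yx: "weyl_y i * weyl_x j = weyl_x j * weyl_y i + (if i = j then 1 else 0 :: ('k, 'n) weyl)"
    using weyl_relations(3)[of i j, where 'k = 'k] by (simp add: algebra_simps split: if_splits)
  have "weyl_y i * weyl_x j ^ Suc m = weyl_x j * (weyl_y i * weyl_x j ^ m)
      + (if i = j then 1 else 0 :: ('k, 'n) weyl) * weyl_x j ^ m"
    by (simp add: mult.assoc[symmetric] yx distrib_right)
  also have "\<dots> = weyl_x j ^ Suc m * weyl_y i
      + (if i = j then weyl_x j * (of_nat m * weyl_x j ^ (m - 1)) + weyl_x j ^ m else 0)"
    by (simp add: Suc distrib_left mult.assoc)
  also have "weyl_x j * (of_nat m * weyl_x j ^ (m - 1)) = of_nat m * (weyl_x j ^ m :: ('k, 'n) weyl)"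
    by (cases m) (simp_all only: of_nat_left_commute diff_Suc_1 power_Suc of_nat_0 mult_zero_left
        mult_zero_right)
  finally show ?case by (simp add: algebra_simps)
qed simp

lemma y_power_prod_x:
  assumes "distinct L"
  shows "weyl_y i * power_prod L weyl_x \<alpha> = (power_prod L weyl_x \<alpha> * weyl_y i
    + (if i \<in> set L then of_nat (\<alpha> i) * power_prod L weyl_x (\<alpha>(i := \<alpha> i - 1)) else 0)
    :: ('k::field, 'n) weyl)"
  using assms
proof (induction L)
  case (Cons j L)
  let ?P = "\<lambda>L \<alpha>. power_prod L weyl_x \<alpha> :: ('k, 'n) weyl"
  have "weyl_y i * ?P (j # L) \<alpha> = weyl_x j ^ \<alpha> j * (weyl_y i * ?P L \<alpha>)
      + (if i = j then of_nat (\<alpha> j) * weyl_x j ^ (\<alpha> j - 1) else 0) * ?P L \<alpha>"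
    by (simp add: power_prod_simps mult.assoc[symmetric] y_mult_x_power distrib_right)
  also have "\<dots> = ?P (j # L) \<alpha> * weyl_y i
      + (weyl_x j ^ \<alpha> j * (if i \<in> set L then of_nat (\<alpha> i) * ?P L (\<alpha>(i := \<alpha> i - 1)) else 0)
        + (if i = j then of_nat (\<alpha> j) * weyl_x j ^ (\<alpha> j - 1) else 0) * ?P L \<alpha>)"
    using Cons by (simp add: power_prod_simps mult.assoc distrib_left)
  also have "weyl_x j ^ \<alpha> j * (if i \<in> set L then of_nat (\<alpha> i) * ?P L (\<alpha>(i := \<alpha> i - 1)) else 0)
        + (if i = j then of_nat (\<alpha> j) * weyl_x j ^ (\<alpha> j - 1) else 0) * ?P L \<alpha>
      = (if i \<in> set (j # L) then of_nat (\<alpha> i) * ?P (j # L) (\<alpha>(i := \<alpha> i - 1)) else 0)"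
  proof (cases "i = j")
    case True
    then have "?P L \<alpha> = ?P L (\<alpha>(i := \<alpha> i - 1))"
      using Cons.prems by (intro power_prod_cong) auto
    then show ?thesis using True Cons.prems by (simp add: power_prod_simps mult.assoc)
  next
    case False
    then show ?thesis by (simp add: power_prod_simps of_nat_left_commute)
  qed
  finally show ?case .
qed (simp add: power_prod_simps)

lemma y_normal_mon:
  "weyl_y i * normal_mon \<alpha> \<beta> = normal_mon \<alpha> (\<beta>(i := \<beta> i + 1))
    + (of_nat (\<alpha> i) * normal_mon (\<alpha>(i := \<alpha> i - 1)) \<beta> :: ('k::field, 'n::finite) weyl)"
proof -
  have "weyl_y i * power_prod index_list weyl_y \<beta>
      = (power_prod index_list weyl_y (\<beta>(i := \<beta> i + 1)) :: ('k, 'n) weyl)"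
    using power_prod_raise[of weyl_y index_list i 1 \<beta>] by (simp add: index_list weyl_relations)
  then show ?thesis
    unfolding normal_mon_def mult.assoc[symmetric]
    by (simp add: y_power_prod_x index_list distrib_right mult.assoc)
qed

text \<open>
  A left inverse of the symbol map: substitute \<open>x\<close> and \<open>y\<close> for \<open>X\<close> and \<open>Y\<close>, all \<open>x\<close> to the left of all \<open>y\<close>.
  Variables of the polynomial ring that belong to no generator are sent to 1.
\<close>

definition normal_order :: "'k::field mpoly \<Rightarrow> ('k, 'n::finite) weyl"
  where "normal_order p = (\<Sum>m\<in>Poly_Mapping.keys p. weyl_const (Poly_Mapping.lookup p m) *
    normal_mon (\<lambda>i. Poly_Mapping.lookup m (x_index i)) (\<lambda>i. Poly_Mapping.lookup m (y_index i)))"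

lemma normal_order_superset:
  assumes "finite A" "Poly_Mapping.keys p \<subseteq> A"
  shows "normal_order p = (\<Sum>m\<in>A. weyl_const (Poly_Mapping.lookup p m) *
    normal_mon (\<lambda>i. Poly_Mapping.lookup m (x_index i)) (\<lambda>i. Poly_Mapping.lookup m (y_index i)))"
  unfolding normal_order_def
  by (rule sum.mono_neutral_left[OF assms]) (simp add: in_keys_iff weyl_const_simps)

lemma normal_order_add: "normal_order (p + q) = normal_order p + normal_order q"
  using keys_add[of p q]
  by (subst (1 2 3) normal_order_superset[of "Poly_Mapping.keys p \<union> Poly_Mapping.keys q"])
    (simp_all add: lookup_add weyl_const_simps distrib_right sum.distrib)

lemma normal_order_single: "normal_order (Poly_Mapping.single m c) = weyl_const c *
    normal_mon (\<lambda>i. Poly_Mapping.lookup m (x_index i)) (\<lambda>i. Poly_Mapping.lookup m (y_index i))"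
  by (subst normal_order_superset[of "{m}"]) auto

lemma normal_order_zero: "normal_order 0 = 0"
  by (simp add: normal_order_def)

lemma normal_order_x:
  "normal_order (pvar (x_index i) * q) = (weyl_x i * normal_order q :: ('k::field, 'n::finite) weyl)"
proof (induction q rule: poly_mapping_sum_induct)
  case (2 m c)
  have "(\<lambda>j :: 'n. Poly_Mapping.lookup (Poly_Mapping.single (x_index i) 1 + m) (x_index j))
      = (\<lambda>j. Poly_Mapping.lookup m (x_index j))(i := Poly_Mapping.lookup m (x_index i) + 1)"
    "(\<lambda>j :: 'n. Poly_Mapping.lookup (Poly_Mapping.single (x_index i) 1 + m) (y_index j))
      = (\<lambda>j. Poly_Mapping.lookup m (y_index j))"
    by (auto simp: lookup_add lookup_single when_def)
  then show ?case
    by (simp add: pvar_def mult_single normal_order_single weyl_const_left_commute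
        x_power_normal_mon[of i 1, simplified])
qed (simp_all add: normal_order_zero normal_order_add distrib_left)

lemma normal_order_y:
  "normal_order (pvar (y_index i) * q + pd (x_index i) q)
    = (weyl_y i * normal_order q :: ('k::field, 'n::finite) weyl)"
proof (induction q rule: poly_mapping_sum_induct)
  case 1
  show ?case by (simp add: normal_order_zero pd_zero)
next
  case (2 m c)
  let ?a = "\<lambda>j :: 'n. Poly_Mapping.lookup m (x_index j)"
    and ?b = "\<lambda>j :: 'n. Poly_Mapping.lookup m (y_index j)"
  have 1: "(\<lambda>j. Poly_Mapping.lookup (Poly_Mapping.single (y_index i) 1 + m) (y_index j))
      = ?b(i := ?b i + 1)"
    "(\<lambda>j. Poly_Mapping.lookup (Poly_Mapping.single (y_index i) 1 + m) (x_index j)) = ?a"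
    by (auto simp: lookup_add lookup_single when_def)
  have 2: "(\<lambda>j. Poly_Mapping.lookup (m - Poly_Mapping.single (x_index i) 1) (x_index j))
      = ?a(i := ?a i - 1)"
    "(\<lambda>j. Poly_Mapping.lookup (m - Poly_Mapping.single (x_index i) 1) (y_index j)) = ?b"
    by (auto simp: lookup_minus lookup_single when_def)
  have "normal_order (pvar (y_index i) * Poly_Mapping.single m c + pd (x_index i) (Poly_Mapping.single m c))
      = (weyl_const c * normal_mon ?a (?b(i := ?b i + 1))
        + weyl_const (of_nat (?a i) * c) * normal_mon (?a(i := ?a i - 1)) ?b
          :: ('k, 'n) weyl)"
    by (simp only: pvar_def mult_single pd_single normal_order_add normal_order_single 1 2 mult_1)
  also have "\<dots> = weyl_const c * (weyl_y i * normal_mon ?a ?b)"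
    by (simp only: y_normal_mon distrib_left mult.commute[of _ c] weyl_const_simps of_nat_weyl mult.assoc)
  also have "\<dots> = weyl_y i * normal_order (Poly_Mapping.single m c)"
    by (simp only: normal_order_single weyl_const_left_commute)
  finally show ?case .
next
  case (3 p q)
  let ?f = "\<lambda>q. pvar (y_index i) * q + pd (x_index i) q"
  have "?f (p + q) = ?f p + ?f q" by (simp add: pd_add distrib_left add_ac)
  then have "normal_order (?f (p + q)) = (normal_order (?f p) + normal_order (?f q) :: ('k, 'n) weyl)"
    by (simp only: normal_order_add[of "?f p" "?f q"])
  then show ?case by (simp only: 3 normal_order_add[of p q] distrib_left)
qed

lemma normal_order_pconst: "normal_order (pconst c) = weyl_const c"
  by (simp add: pconst_def normal_order_single normal_mon_def power_prod_zero)

lemma symbol_simps: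
  "symbol 0 = 0" "symbol 1 = 1" "symbol (weyl_const c) = pconst c"
  "symbol (a + b) = symbol a + symbol b" "symbol (a - b) = symbol a - symbol b"
  "symbol (weyl_x i * a) = pvar (x_index i) * symbol a"
  "symbol (weyl_y i * a) = pvar (y_index i) * symbol a + pd (x_index i) (symbol a)"
  by (simp_all add: symbol_def weyl_op_simps)

text \<open>
  Normal ordering intertwines the action on polynomials with left multiplication
  (\<open>normal_order_x\<close>, \<open>normal_order_y\<close>), so \<open>a\<cdot>1\<close> goes to \<open>a * 1\<close>. In particular an element of the Weyl
  algebra is determined by its symbol.
\<close>

lemma normal_order_symbol: "normal_order (symbol a) = a"
proof (induction a rule: weyl_induct)
  case (y i a)
  then show ?case by (simp only: symbol_simps normal_order_y)
qed (simp_all add: symbol_simps normal_order_pconst normal_order_add normal_order_x)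

lemma symbol_eq_0_iff: "symbol a = 0 \<longleftrightarrow> a = 0"
  using normal_order_symbol[of a] by (auto simp: normal_order_zero symbol_simps)

section \<open>The filtration by order in the y-variables\<close>

definition weight :: "(nat \<Rightarrow> nat) \<Rightarrow> (nat \<Rightarrow>\<^sub>0 nat) \<Rightarrow> nat"
  where "weight f m = (\<Sum>v\<in>Poly_Mapping.keys m. f v * Poly_Mapping.lookup m v)"

lemma weight_superset:
  assumes "finite A" "Poly_Mapping.keys m \<subseteq> A"
  shows "weight f m = (\<Sum>v\<in>A. f v * Poly_Mapping.lookup m v)"
  unfolding weight_def
  by (rule sum.mono_neutral_left[OF assms]) (simp add: in_keys_iff)

lemma weight_add: "weight f (m + m') = weight f m + weight f m'"
  using keys_add[of m m']
  by (subst (1 2 3) weight_superset[of "Poly_Mapping.keys m \<union> Poly_Mapping.keys m'"])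
    (simp_all add: lookup_add distrib_left sum.distrib)

lemma weight_single: "weight f (Poly_Mapping.single v n) = f v * n"
  by (subst weight_superset[of "{v}"]) auto

text \<open>
  The \<open>Y\<close>-variables are the ones with odd index.
\<close>

abbreviation y_weight :: "(nat \<Rightarrow>\<^sub>0 nat) \<Rightarrow> nat"
  where "y_weight \<equiv> weight (\<lambda>v. v mod 2)"

lemma y_weight_single:
  "y_weight (Poly_Mapping.single (x_index i) n) = 0"
  "y_weight (Poly_Mapping.single (y_index i) n) = n"
  by (simp_all add: weight_single x_index_def y_index_def)

lemma below_pvar:
  "below y_weight (Suc 0) (pvar (x_index i))" "below y_weight (Suc (Suc 0)) (pvar (y_index i))"
  by (simp_all add: below_def pvar_def y_weight_single[unfolded One_nat_def])

lemma sum_y_index_le_y_weight: "sum_list (map (\<lambda>i. Poly_Mapping.lookup m (y_index i)) (index_list :: 'n::finite list)) \<le> y_weight m"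
proof -
  let ?A = "range (y_index :: 'n \<Rightarrow> nat)"
  have "sum_list (map (\<lambda>i. Poly_Mapping.lookup m (y_index i)) (index_list :: 'n list))
      = (\<Sum>i\<in>(UNIV :: 'n set). Poly_Mapping.lookup m (y_index i))"
    by (simp add: sum_list_distinct_conv_sum_set index_list)
  also have "\<dots> = (\<Sum>v\<in>?A. Poly_Mapping.lookup m v)"
    by (simp add: sum.reindex inj_def)
  also have "\<dots> = (\<Sum>v\<in>?A. v mod 2 * Poly_Mapping.lookup m v)"
    by (intro sum.cong) (auto simp: y_index_def)
  also have "\<dots> \<le> (\<Sum>v\<in>Poly_Mapping.keys m \<union> ?A. v mod 2 * Poly_Mapping.lookup m v)"
    by (intro sum_mono2) auto
  also have "\<dots> = y_weight m" by (intro weight_superset[symmetric]) auto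
  finally show ?thesis .
qed

text \<open>
  Up to lower order in \<open>Y\<close>, the element \<open>a\<close> of order at most \<open>d\<close> acts as multiplication by its symbol. The
  property passes from \<open>a\<close> to \<open>x\<^sub>i a\<close> and \<open>y\<^sub>i a\<close>, as \<open>\<partial>/\<partial>X\<^sub>i\<close> does not raise the order while \<open>Y\<^sub>i\<close> raises it
  by one.
\<close>

definition acts_to_order :: "nat \<Rightarrow> ('k::field, 'n::finite) weyl \<Rightarrow> bool"
  where "acts_to_order d a \<longleftrightarrow> below y_weight (Suc d) (symbol a) \<and>
    (\<forall>e q. below y_weight (Suc e) q \<longrightarrow> below y_weight (d + e) (weyl_op a q - symbol a * q))"

lemma acts_to_order_mono: "acts_to_order d a \<Longrightarrow> d \<le> d' \<Longrightarrow> acts_to_order d' a"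
  unfolding acts_to_order_def by (meson below_mono Suc_le_mono add_right_mono)

lemma acts_to_order_add:
  assumes "acts_to_order d a" "acts_to_order d b"
  shows "acts_to_order d (a + b)"
  unfolding acts_to_order_def
proof (intro conjI allI impI)
  show "below y_weight (Suc d) (symbol (a + b))"
    using assms by (simp add: acts_to_order_def symbol_simps below_add)
  fix e and q :: "'a mpoly"
  assume "below y_weight (Suc e) q"
  then have "below y_weight (d + e) ((weyl_op a q - symbol a * q) + (weyl_op b q - symbol b * q))"
    using assms by (intro below_add) (auto simp: acts_to_order_def)
  moreover have "weyl_op (a + b) q - symbol (a + b) * q
      = (weyl_op a q - symbol a * q) + (weyl_op b q - symbol b * q)"
    by (simp add: weyl_op_simps symbol_simps distrib_right)
  ultimately show "below y_weight (d + e) (weyl_op (a + b) q - symbol (a + b) * q)"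
    by (simp only:)
qed

lemma acts_to_order_const_mult:
  assumes "acts_to_order d a"
  shows "acts_to_order d (weyl_const c * a)"
proof -
  have s: "symbol (weyl_const c * a) = pconst c * symbol a" by (simp add: symbol_def weyl_op_simps)
  have c: "below y_weight (Suc 0) (pconst c)"
    by (auto simp: below_def pconst_def weight_def split: if_splits)
  have "below y_weight (0 + Suc d) (pconst c * symbol a)"
    using assms by (intro below_mult weight_add c) (simp add: acts_to_order_def)
  moreover have "below y_weight (d + e) (weyl_op (weyl_const c * a) q - symbol (weyl_const c * a) * q)"
    if "below y_weight (Suc e) q" for e q
  proof -
    have "below y_weight (0 + (d + e)) (pconst c * (weyl_op a q - symbol a * q))"
      using assms that by (intro below_mult weight_add c) (auto simp: acts_to_order_def)
    then show ?thesis by (simp add: s weyl_op_simps right_diff_distrib mult.assoc)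
  qed
  ultimately show ?thesis by (simp add: acts_to_order_def s)
qed

lemma acts_to_order_x:
  assumes "acts_to_order d a"
  shows "acts_to_order d (weyl_x i * a)"
proof -
  have "below y_weight (0 + Suc d) (pvar (x_index i) * symbol a)"
    using assms by (intro below_mult weight_add below_pvar) (simp add: acts_to_order_def)
  moreover have "below y_weight (d + e) (weyl_op (weyl_x i * a) q - symbol (weyl_x i * a) * q)"
    if "below y_weight (Suc e) q" for e q
  proof -
    have "below y_weight (0 + (d + e)) (pvar (x_index i) * (weyl_op a q - symbol a * q))"
      using assms that by (intro below_mult weight_add below_pvar) (auto simp: acts_to_order_def)
    then show ?thesis by (simp add: symbol_simps weyl_op_simps right_diff_distrib mult.assoc)
  qed
  ultimately show ?thesis by (simp add: acts_to_order_def symbol_simps)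
qed

lemma acts_to_order_y:
  assumes "acts_to_order d a"
  shows "acts_to_order (Suc d) (weyl_y i * a)"
proof -
  have pd: "below y_weight l (pd (x_index i) q)" if "below y_weight l q" for l and q :: "'a mpoly"
    using below_pd[OF weight_add that, of "x_index i"] by (simp add: y_weight_single)
  have a: "below y_weight (Suc d) (symbol a)" using assms by (simp add: acts_to_order_def)
  have "below y_weight (Suc 0 + Suc d) (pvar (y_index i) * symbol a)"
    by (intro below_mult weight_add below_pvar a)
  then have "below y_weight (Suc (Suc d)) (symbol (weyl_y i * a))"
    unfolding symbol_simps using pd[OF a] by (intro below_add) (auto elim: below_mono)
  moreover have "below y_weight (Suc d + e) (weyl_op (weyl_y i * a) q - symbol (weyl_y i * a) * q)"
    if q: "below y_weight (Suc e) q" for e q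
  proof -
    have 1: "below y_weight (d + e) (weyl_op a q - symbol a * q)"
      using assms q by (auto simp: acts_to_order_def)
    have "below y_weight (Suc 0 + (d + e)) (pvar (y_index i) * (weyl_op a q - symbol a * q))"
      by (intro below_mult weight_add below_pvar 1)
    moreover have "below y_weight (d + Suc e) (weyl_op a q)"
    proof -
      have "below y_weight (d + Suc e) ((weyl_op a q - symbol a * q) + symbol a * q)"
        by (intro below_add below_mult weight_add a q below_mono[OF 1]) simp
      then show ?thesis by simp
    qed
    then have "below y_weight (d + Suc e) (pd (x_index i) (weyl_op a q) - pd (x_index i) (symbol a) * q)"
      by (intro below_diff below_mult weight_add pd a q)
    ultimately have "below y_weight (Suc d + e) (pvar (y_index i) * (weyl_op a q - symbol a * q)
        + (pd (x_index i) (weyl_op a q) - pd (x_index i) (symbol a) * q))"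
      by (intro below_add) simp_all
    moreover have "weyl_op (weyl_y i * a) q - symbol (weyl_y i * a) * q
        = pvar (y_index i) * (weyl_op a q - symbol a * q)
          + (pd (x_index i) (weyl_op a q) - pd (x_index i) (symbol a) * q)"
      by (simp add: symbol_simps weyl_op_simps right_diff_distrib distrib_right mult.assoc)
    ultimately show ?thesis by (simp only:)
  qed
  ultimately show ?thesis by (simp add: acts_to_order_def)
qed

lemma acts_to_order_zero: "acts_to_order d 0"
  by (simp add: acts_to_order_def symbol_simps weyl_op_simps below_zero)

lemma acts_to_order_one: "acts_to_order 0 1"
  by (auto simp: acts_to_order_def symbol_simps weyl_op_simps below_zero below_def weight_def)

lemma acts_to_order_normal_mon:
  "acts_to_order (sum_list (map \<beta> index_list)) (normal_mon \<alpha> \<beta> :: ('k::field, 'n::finite) weyl)"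
proof -
  have x: "acts_to_order d (weyl_x i ^ l * a)" if "acts_to_order d a"
    for d i l and a :: "('k, 'n) weyl"
    by (induction l) (simp_all add: that acts_to_order_x mult.assoc)
  have y: "acts_to_order (l + d) (weyl_y i ^ l * a)" if "acts_to_order d a"
    for d i l and a :: "('k, 'n) weyl"
    by (induction l) (simp_all add: that acts_to_order_y mult.assoc)
  have xs: "acts_to_order d (power_prod L weyl_x \<alpha> * a)" if "acts_to_order d a"
    for d L and a :: "('k, 'n) weyl"
    by (induction L) (simp_all add: that power_prod_simps x mult.assoc)
  have ys: "acts_to_order (sum_list (map \<beta> L)) (power_prod L weyl_y \<beta> :: ('k, 'n) weyl)" for L
    by (induction L) (simp_all add: acts_to_order_one power_prod_simps y)
  show ?thesis unfolding normal_mon_def by (intro xs ys)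
qed

definition y_degree :: "('k::field, 'n::finite) weyl \<Rightarrow> nat"
  where "y_degree a = degree (graded y_weight (symbol a))"

definition principal_symbol :: "('k::field, 'n::finite) weyl \<Rightarrow> 'k mpoly"
  where "principal_symbol a = lead_coeff (graded y_weight (symbol a))"

text \<open>
  The number of letters \<open>y\<close> in a word expression of \<open>a\<close> may exceed the order of \<open>a\<close>, as top terms
  may cancel. The normally ordered expression of \<open>a\<close> has no cancellation:
  each of its monomials has order at most that of \<open>a\<close>.
\<close>

lemma acts_to_order_y_degree: "acts_to_order (y_degree a) (a :: ('k::field, 'n::finite) weyl)"
proof -
  let ?N = "\<lambda>m. normal_mon (\<lambda>i. Poly_Mapping.lookup m (x_index i)) (\<lambda>i. Poly_Mapping.lookup m (y_index i))
    :: ('k, 'n) weyl"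
  have mon: "acts_to_order (y_degree a) (weyl_const c * ?N m)" if "m \<in> Poly_Mapping.keys (symbol a)" for m c
  proof -
    have "below y_weight (Suc (y_degree a)) (symbol a)" by (simp add: below_Suc_iff y_degree_def)
    with that have "y_weight m \<le> y_degree a" by (auto simp: below_def)
    then have "sum_list (map (\<lambda>i. Poly_Mapping.lookup m (y_index i)) (index_list :: 'n list)) \<le> y_degree a"
      using sum_y_index_le_y_weight le_trans by blast
    then show ?thesis
      by (intro acts_to_order_const_mult acts_to_order_mono[OF acts_to_order_normal_mon])
  qed
  have "acts_to_order (y_degree a) (\<Sum>m\<in>A. weyl_const (Poly_Mapping.lookup (symbol a) m) * ?N m)"
    if "finite A" "A \<subseteq> Poly_Mapping.keys (symbol a)" for A
    using that by (induction A rule: finite_induct) (simp_all add: acts_to_order_zero acts_to_order_add mon)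
  from this[of "Poly_Mapping.keys (symbol a)"]
  have "acts_to_order (y_degree a) (normal_order (symbol a) :: ('k, 'n) weyl)"
    by (simp add: normal_order_def)
  then show ?thesis by (simp only: normal_order_symbol)
qed

lemma symbol_mult_below:
  "below y_weight (y_degree a + y_degree b) (symbol (a * b) - symbol a * symbol b)"
proof -
  have "below y_weight (Suc (y_degree b)) (symbol b)" by (simp add: below_Suc_iff y_degree_def)
  then show ?thesis
    using acts_to_order_y_degree[of a] by (simp add: acts_to_order_def symbol_def weyl_op_simps)
qed

lemma
  assumes "a \<noteq> 0" "b \<noteq> 0"
  shows weyl_mult_nonzero: "a * b \<noteq> (0 :: ('k::field, 'n::finite) weyl)"
    and y_degree_mult: "y_degree (a * b) = y_degree a + y_degree b"
    and principal_symbol_mult: "principal_symbol (a * b) = principal_symbol a * principal_symbol b"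
proof -
  have nz: "symbol a \<noteq> 0" "symbol b \<noteq> 0" using assms by (simp_all add: symbol_eq_0_iff)
  note top = graded_top_coeff[of y_weight, OF weight_add nz symbol_mult_below[unfolded y_degree_def]]
  show "a * b \<noteq> 0" using top(1) by (simp add: symbol_eq_0_iff)
  show "y_degree (a * b) = y_degree a + y_degree b" "principal_symbol (a * b) = principal_symbol a * principal_symbol b"
    using top(2,3) by (simp_all only: y_degree_def principal_symbol_def)
qed

lemma y_degree_diff: "y_degree (a - b) \<le> max (y_degree a) (y_degree b)"
  by (simp add: y_degree_def symbol_simps graded_diff degree_diff_le_max)

text \<open>
  Since \<open>a b\<close> and \<open>b a\<close> both have the symbol \<open>symbol a * symbol b\<close> up to lower order, and polynomials
  commute.
\<close>

lemma y_degree_commutator: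
  assumes "a * b \<noteq> b * a"
  shows "y_degree (a * b - b * a) < y_degree a + y_degree b"
proof -
  have "below y_weight (y_degree a + y_degree b) ((symbol (a * b) - symbol a * symbol b) - (symbol (b * a) - symbol b * symbol a))"
    using symbol_mult_below[of a b] symbol_mult_below[of b a] by (intro below_diff[of _ _ "symbol (a * b) - _"]) (simp_all add: add.commute)
  moreover have "symbol (a * b - b * a) = (symbol (a * b) - symbol a * symbol b) - (symbol (b * a) - symbol b * symbol a)"
    by (simp add: symbol_simps mult.commute)
  ultimately have "below y_weight (y_degree a + y_degree b) (symbol (a * b - b * a))" by (simp only:)
  moreover have "symbol (a * b - b * a) \<noteq> 0" using assms by (simp add: symbol_eq_0_iff)
  ultimately show ?thesis by (simp add: below_degree y_degree_def)
qed

lemma principal_symbol_power: "b \<noteq> 0 \<Longrightarrow> b ^ m \<noteq> 0 \<and> principal_symbol (b ^ m) = principal_symbol b ^ m"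
proof (induction m)
  case 0
  show ?case by (simp add: principal_symbol_def symbol_simps graded_one[of y_weight, OF weight_add])
qed (simp add: weyl_mult_nonzero principal_symbol_mult)

lemma principal_symbol_cong:
  assumes "a - b \<noteq> 0 \<Longrightarrow> y_degree (a - b) < y_degree a" "a \<noteq> 0"
  shows "b \<noteq> 0 \<and> principal_symbol a = principal_symbol b"
proof -
  have "graded y_weight (symbol b) = graded y_weight (symbol a) - graded y_weight (symbol (a - b))"
    by (simp add: symbol_simps graded_diff)
  moreover have *: "coeff (graded y_weight (symbol (a - b))) e = 0" if "e \<ge> y_degree a" for e
    using assms(1) that by (cases "a - b = 0") (auto simp: y_degree_def coeff_eq_0 symbol_simps graded_zero)
  ultimately have eq: "coeff (graded y_weight (symbol b)) e = coeff (graded y_weight (symbol a)) e"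
    if "e \<ge> y_degree a" for e using that by simp
  have nz: "lead_coeff (graded y_weight (symbol a)) \<noteq> 0"
    using assms(2) by (simp add: graded_eq_0_iff symbol_eq_0_iff)
  have b: "b \<noteq> 0" using nz eq[of "y_degree a"] by (auto simp: symbol_simps graded_zero y_degree_def)
  have "degree (graded y_weight (symbol b)) = y_degree a"
  proof (rule antisym)
    show "degree (graded y_weight (symbol b)) \<le> y_degree a"
      by (intro degree_le allI impI) (simp add: eq y_degree_def coeff_eq_0)
    show "y_degree a \<le> degree (graded y_weight (symbol b))"
      using nz eq[of "y_degree a"] by (intro le_degree) (simp add: y_degree_def)
  qed
  then have "principal_symbol a = principal_symbol b" using eq[of "y_degree a"] by (simp add: principal_symbol_def y_degree_def)
  with b show ?thesis by simp
qed

text \<open>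
  With \<open>f\<close> the principal symbol of \<open>b\<close> and \<open>d\<close> its order, the principal symbol of \<open>g = y\<^sup>d + x b\<close> is
  \<open>P = Y\<^sup>d + X f\<close>, since \<open>x\<close> has order 0. Now \<open>X f \<equiv> - Y\<^sup>d\<close> modulo \<open>P\<close>, so if \<open>P\<close>
  divided a power of \<open>f\<close>, it would divide a power of \<open>Y\<^sup>d\<close>. Degrees in \<open>X\<close> exclude this.
\<close>

lemma exists_nondivisor:
  fixes b :: "('k::field, 'n::finite) weyl"
  assumes "b \<noteq> 0"
  shows "\<exists>g. g \<noteq> 0 \<and> (\<forall>m a. b ^ m - g * a \<noteq> 0 \<and> y_degree (b ^ m) \<le> y_degree (b ^ m - g * a))"
proof -
  fix i :: 'n
  define d where "d = y_degree b"
  define f where "f = principal_symbol b"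
  define X Y :: "'k mpoly" where "X = pvar (x_index i)" and "Y = pvar (y_index i)"
  define g where "g = weyl_y i ^ d + weyl_x i * b"
  define P where "P = Y ^ d + X * f"
  let ?G = "graded y_weight" and ?X = "\<lambda>m. Poly_Mapping.lookup m (x_index i)"
  have f: "f \<noteq> 0" using assms by (simp add: f_def principal_symbol_def graded_eq_0_iff symbol_eq_0_iff)
  have XY: "X \<noteq> 0" "Y \<noteq> 0"
    by (simp_all add: X_def Y_def pvar_nonzero)
  have symbol_y: "symbol (weyl_y i ^ l) = Y ^ l" for l
    by (induction l) (simp_all add: symbol_simps Y_def pd_pvar_power)
  have symbol_g: "symbol g = Y ^ d + X * symbol b"
    by (simp add: g_def symbol_simps symbol_y X_def)
  \<comment> \<open>\<open>y\<^sub>i\<^sup>d\<close> is homogeneous of order \<open>d\<close> and \<open>x\<^sub>i\<close> has order 0, so both summands contribute to order \<open>d\<close>.\<close>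
  have graded_g: "?G (symbol g) = monom (Y ^ d) d + smult X (?G (symbol b))"
    by (simp add: symbol_g graded_add graded_mult[of y_weight, OF weight_add] X_def Y_def monom_0
        graded_pvar[of y_weight, OF weight_add] graded_pvar_power[of y_weight, OF weight_add]
        y_weight_single)
  have coeff_g: "coeff (?G (symbol g)) d = P"
    by (simp add: graded_g P_def f_def principal_symbol_def d_def y_degree_def)
  have graded_Yd: "graded ?X (Y ^ d) = [:Y ^ d:]"
    by (simp add: Y_def graded_pvar_power[of ?X, OF lookup_add] lookup_single monom_0)
  have P_x_degree: "degree (graded ?X P) > 0"
  proof -
    have 2: "graded ?X (X * f) = monom X 1 * graded ?X f"
      by (simp add: X_def graded_mult[of ?X, OF lookup_add] graded_pvar[of ?X, OF lookup_add])
    have "degree (graded ?X (X * f)) = Suc (degree (graded ?X f))"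
      unfolding 2 using f XY by (subst degree_mult_eq) (auto simp: graded_eq_0_iff degree_monom_eq)
    then show ?thesis by (simp add: P_def graded_add graded_Yd degree_add_eq_right)
  qed
  then have P: "P \<noteq> 0" by (auto simp: graded_zero)
  have y_degree_g: "y_degree g = d"
    unfolding y_degree_def
  proof (rule antisym)
    show "degree (?G (symbol g)) \<le> d"
      unfolding graded_g by (intro degree_add_le degree_monom_le order.trans[OF degree_smult_le])
        (simp add: d_def y_degree_def)
    show "d \<le> degree (?G (symbol g))" by (rule le_degree) (simp add: coeff_g P)
  qed
  have principal_g: "principal_symbol g = P"
    using coeff_g y_degree_g by (simp add: principal_symbol_def y_degree_def)
  have g: "g \<noteq> 0" using coeff_g P by (auto simp: symbol_simps graded_zero)
  have "b ^ m - g * a \<noteq> 0 \<and> y_degree (b ^ m) \<le> y_degree (b ^ m - g * a)" for m a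
  proof (rule ccontr)
    assume "\<not> ?thesis"
    then have small: "b ^ m - g * a \<noteq> 0 \<Longrightarrow> y_degree (b ^ m - g * a) < y_degree (b ^ m)" by auto
    have bm: "b ^ m \<noteq> 0" "principal_symbol (b ^ m) = f ^ m"
      using principal_symbol_power[OF assms] by (auto simp: f_def)
    from principal_symbol_cong[OF small bm(1)] have ga: "g * a \<noteq> 0" "principal_symbol (b ^ m) = principal_symbol (g * a)"
      by auto
    then have "a \<noteq> 0" by auto
    then have "f ^ m = P * principal_symbol a"
      using bm(2) ga(2) principal_symbol_mult[OF g, of a] by (simp add: principal_g)
    then have "P dvd f ^ m" by simp
    then have "P dvd X ^ m * f ^ m" by (rule dvd_mult)
    then have 1: "P dvd (X * f) ^ m" by (simp only: power_mult_distrib)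
    have "X * f - (- (Y ^ d)) dvd (X * f) ^ m - (- (Y ^ d)) ^ m"
      unfolding power_diff_sumr2 by (rule dvd_triv_left)
    moreover have "X * f - (- (Y ^ d)) = P" by (simp add: P_def)
    ultimately have "P dvd (X * f) ^ m - (- (Y ^ d)) ^ m" by (simp only:)
    from dvd_diff[OF 1 this] have "P dvd (- (Y ^ d)) ^ m" by simp
    then obtain Q where Q: "(- (Y ^ d)) ^ m = P * Q" by blast
    have "(- (Y ^ d)) ^ m \<noteq> 0" using XY by simp
    with Q have "Q \<noteq> 0" by auto
    have neg: "graded ?X (- (Y ^ d)) = [:- (Y ^ d):]"
      using graded_diff[of ?X 0 "Y ^ d"] by (simp add: graded_Yd graded_zero)
    have "degree (graded ?X (- (Y ^ d)) ^ m) \<le> 0"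
      using degree_power_le[of "graded ?X (- (Y ^ d))" m] by (simp add: neg)
    then have "degree (graded ?X ((- (Y ^ d)) ^ m)) = 0"
      by (simp add: graded_power[of ?X, OF lookup_add])
    then have "degree (graded ?X P * graded ?X Q) = 0"
      by (simp add: Q graded_mult[of ?X, OF lookup_add])
    then show False
      using P_x_degree \<open>Q \<noteq> 0\<close> P by (subst (asm) degree_mult_eq) (auto simp: graded_eq_0_iff)
  qed
  with g show ?thesis by blast
qed

section \<open>Linear algebra over the center\<close>

lemma center_commutes: "z \<in> center \<Longrightarrow> z * d = d * z"
  by (simp add: center_def)

lemma center_mult:
  assumes "y \<in> center" "z \<in> center"
  shows "y * z \<in> center"
proof -
  have "y * z * d = d * (y * z)" for d
    by (simp only: mult.assoc center_commutes[OF assms(2), of d])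
      (simp only: mult.assoc[symmetric] center_commutes[OF assms(1), of d])
  then show ?thesis by (simp add: center_def)
qed

text \<open>
  The center as a type, which makes \<open>D\<close> an instance of the general theory of vector spaces.
\<close>

typedef (overloaded) 'd center_elt = "center :: 'd::division_ring set"
  by (rule exI[of _ 0]) (simp add: center_def)

setup_lifting type_definition_center_elt

instantiation center_elt :: (division_ring) field
begin

lift_definition zero_center_elt :: "'a center_elt" is 0 by (simp add: center_def)
lift_definition one_center_elt :: "'a center_elt" is 1 by (simp add: center_def)
lift_definition plus_center_elt :: "'a center_elt \<Rightarrow> 'a center_elt \<Rightarrow> 'a center_elt" is "(+)"
  by (simp add: center_def distrib_left distrib_right)
lift_definition minus_center_elt :: "'a center_elt \<Rightarrow> 'a center_elt \<Rightarrow> 'a center_elt" is "(-)"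
  by (simp add: center_def left_diff_distrib right_diff_distrib)
lift_definition uminus_center_elt :: "'a center_elt \<Rightarrow> 'a center_elt" is uminus
  by (simp add: center_def)
lift_definition times_center_elt :: "'a center_elt \<Rightarrow> 'a center_elt \<Rightarrow> 'a center_elt" is "(*)"
  by (rule center_mult)
lift_definition inverse_center_elt :: "'a center_elt \<Rightarrow> 'a center_elt" is inverse
proof -
  fix z :: 'a
  assume "z \<in> center"
  then show "inverse z \<in> center"
    unfolding center_def by (blast intro: mult_commute_imp_mult_inverse_commute)
qed
definition divide_center_elt :: "'a center_elt \<Rightarrow> 'a center_elt \<Rightarrow> 'a center_elt"
  where "divide_center_elt a b = a * inverse b"

instance
proof
  fix a b c :: "'a center_elt"
  show "a * b = b * a" by transfer (rule center_commutes)
  show "a \<noteq> 0 \<Longrightarrow> inverse a * a = 1" by transfer simp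
  show "a div b = a * inverse b" by (rule divide_center_elt_def)
qed (transfer; simp add: mult.assoc distrib_left distrib_right)+

end

definition center_scale :: "'d::division_ring center_elt \<Rightarrow> 'd \<Rightarrow> 'd"
  where "center_scale z d = Rep_center_elt z * d"

global_interpretation center_vs: vector_space center_scale
  by unfold_locales
    (simp_all add: center_scale_def plus_center_elt.rep_eq times_center_elt.rep_eq
      one_center_elt.rep_eq distrib_left distrib_right mult.assoc)

lemma center_scale_mult_right: "x * center_scale z d = center_scale z (x * d)"
proof -
  have "Rep_center_elt z \<in> center" by (rule Rep_center_elt)
  then have "x * Rep_center_elt z = Rep_center_elt z * x" by (simp add: center_def)
  then show ?thesis by (simp add: center_scale_def mult.assoc[symmetric])
qed

lemma center_mult_span:
  assumes "z \<in> center" "d \<in> center_vs.span B"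
  shows "z * d \<in> center_vs.span B"
  using center_vs.span_scale[OF assms(2), of "Abs_center_elt z"] assms(1)
  by (simp add: center_scale_def Abs_center_elt_inverse)

lemma left_mult_span:
  assumes "\<And>b. b \<in> B \<Longrightarrow> x * b \<in> center_vs.span C" "d \<in> center_vs.span B"
  shows "x * d \<in> center_vs.span C"
  using assms(2)
proof (induction rule: center_vs.span_induct_alt)
  case (step c b d)
  then show ?case
    by (simp add: distrib_left center_scale_mult_right center_vs.span_add center_vs.span_scale assms(1))
qed (simp add: center_vs.span_zero)

lemma finite_dimensional_if_span:
  fixes B :: "'d::division_ring set"
  assumes "finite B" "center_vs.span B = UNIV"
  shows "finite_dimensional_over (center :: 'd set)"
  unfolding finite_dimensional_over_def
proof (intro exI[of _ B] conjI allI assms(1))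
  fix d
  have "d \<in> range (\<lambda>u. \<Sum>b\<in>B. center_scale (u b) b)"
    using center_vs.span_finite[OF assms(1)] assms(2) by blast
  then obtain u where "d = (\<Sum>b\<in>B. center_scale (u b) b)" by blast
  then show "\<exists>c. (\<forall>b\<in>B. c b \<in> center) \<and> d = (\<Sum>b\<in>B. c b * b)"
    by (intro exI[of _ "\<lambda>b. Rep_center_elt (u b)"]) (simp add: center_scale_def Rep_center_elt)
qed

text \<open>
  Left multiplication by \<open>x\<close> is an injective linear endomorphism of a finite dimensional space, hence
  surjective, and so reaches 1.
\<close>

lemma inverse_in_finite_span:
  assumes fin: "finite B" and x: "x \<noteq> 0" and one: "1 \<in> center_vs.span B"
    and closed: "\<And>d. d \<in> center_vs.span B \<Longrightarrow> x * d \<in> center_vs.span B"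
  shows "inverse x \<in> center_vs.span B"
proof -
  obtain C where C: "C \<subseteq> B" "center_vs.independent C" "B \<subseteq> center_vs.span C"
    by (rule center_vs.maximal_independent_subset)
  have finC: "finite C" using C(1) fin finite_subset by blast
  have span: "center_vs.span C = center_vs.span B"
    using C by (metis center_vs.span_eq center_vs.span_superset subset_trans)
  interpret h: module_hom center_scale center_scale "(*) x"
    by unfold_locales (simp_all add: distrib_left center_scale_mult_right)
  have inj: "inj ((*) x)" using x by (simp add: inj_def)
  have ind: "center_vs.independent ((*) x ` C)"
    by (rule h.independent_inj_image[OF C(2) inj])
  have "1 \<in> center_vs.span ((*) x ` C)"
  proof (rule ccontr)
    assume not: "1 \<notin> center_vs.span ((*) x ` C)"
    have "insert 1 ((*) x ` C) \<subseteq> center_vs.span C"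
      using closed one C(1) by (auto simp: span center_vs.span_base)
    with center_vs.independent_span_bound[OF finC center_vs.independent_insertI[OF not ind]]
    have "card (insert 1 ((*) x ` C)) \<le> card C" by blast
    moreover have "1 \<notin> (*) x ` C" using not center_vs.span_base by blast
    ultimately show False
      using finC inj by (simp add: card_image inj_on_subset[OF inj])
  qed
  then obtain d where "1 = x * d" "d \<in> center_vs.span C" unfolding h.span_image by blast
  then show ?thesis using inverse_unique[of x d] by (simp add: span)
qed

section \<open>Positive characteristic\<close>

lemma y_power_x:
  "weyl_y j ^ m * weyl_x i = (weyl_x i * weyl_y j ^ m + (if i = j then of_nat m * weyl_y j ^ (m - 1) else 0)
    :: ('k::field, 'n) weyl)"
proof (induction m)
  case (Suc m)
  have yx: "weyl_y j * weyl_x i = weyl_x i * weyl_y j + (if i = j then 1 else 0 :: ('k, 'n) weyl)"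
    using weyl_relations(3)[of j i, where 'k = 'k] by (simp add: algebra_simps split: if_splits)
  have "weyl_y j ^ Suc m * weyl_x i = weyl_y j ^ m * (weyl_y j * weyl_x i :: ('k, 'n) weyl)"
    by (simp only: power_Suc2 mult.assoc)
  also have "\<dots> = (weyl_y j ^ m * weyl_x i) * weyl_y j + weyl_y j ^ m * (if i = j then 1 else 0)"
    by (simp only: yx distrib_left mult.assoc)
  also have "\<dots> = weyl_x i * weyl_y j ^ Suc m
      + (if i = j then of_nat m * (weyl_y j ^ (m - 1) * weyl_y j) + weyl_y j ^ m else 0)"
    by (simp add: Suc distrib_right mult.assoc power_Suc2 del: power_Suc)
  also have "of_nat m * (weyl_y j ^ (m - 1) * weyl_y j) = of_nat m * (weyl_y j ^ m :: ('k, 'n) weyl)"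
    by (cases m) (simp_all add: power_Suc2 del: power_Suc)
  finally show ?case by (simp add: algebra_simps)
qed simp

lemma weyl_central_if_commutes:
  fixes a :: "('k::field, 'n) weyl"
  assumes "\<And>i. a * weyl_x i = weyl_x i * a" "\<And>i. a * weyl_y i = weyl_y i * a"
  shows "a * b = b * a"
proof (induction b rule: weyl_induct)
  case (const c)
  show ?case by (rule weyl_const_central[symmetric])
next
  case (add b c)
  then show ?case by (simp add: distrib_left distrib_right)
next
  case (x i b)
  then show ?case by (metis assms(1) mult.assoc)
next
  case (y i b)
  then show ?case by (metis assms(2) mult.assoc)
qed

text \<open>
  The commutators \<open>[y, x\<^sup>p] = p x\<^sup>p\<^sup>-\<^sup>1\<close> and \<open>[y\<^sup>p, x] = p y\<^sup>p\<^sup>-\<^sup>1\<close> vanish.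
\<close>

lemma weyl_power_char_central:
  fixes b :: "('k::field, 'n) weyl"
  assumes "of_nat p = (0 :: 'k)"
  shows "weyl_x j ^ p * b = b * weyl_x j ^ p" "weyl_y j ^ p * b = b * weyl_y j ^ p"
proof -
  have p: "of_nat p = (0 :: ('k, 'n) weyl)"
    by (simp add: of_nat_weyl assms weyl_const_simps)
  show "weyl_x j ^ p * b = b * weyl_x j ^ p"
    by (rule weyl_central_if_commutes)
      (simp_all add: power_commuting_commutes[OF weyl_relations(1)] y_mult_x_power p)
  show "weyl_y j ^ p * b = b * weyl_y j ^ p"
    by (rule weyl_central_if_commutes)
      (simp_all add: power_commuting_commutes[OF weyl_relations(2)] y_power_x p)
qed

lemma frac_central:
  assumes "division_ring_of_fractions \<iota>" "\<And>b. a * b = b * a"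
  shows "\<iota> a \<in> center"
proof -
  have comm: "\<iota> a * \<iota> b = \<iota> b * \<iota> a" for b
    using assms(2)[of b] by (simp flip: frac_mult[OF assms(1)])
  have "\<iota> a * d = d * \<iota> a" for d
  proof -
    obtain b c where bc: "c \<noteq> 0" "d = \<iota> b * inverse (\<iota> c)"
      using frac_exhaust[OF assms(1)] by blast
    have inv: "\<iota> a * inverse (\<iota> c) = inverse (\<iota> c) * \<iota> a"
      by (rule mult_commute_imp_mult_inverse_commute[symmetric]) (rule comm[symmetric])
    show ?thesis unfolding bc(2) by (metis comm inv mult.assoc)
  qed
  then show ?thesis by (simp add: center_def)
qed

text \<open>
  The factors \<open>x\<close> stand to the left of \<open>y\<^sub>i\<^sup>p\<close>, which can only be moved past them because it is central.
\<close>

lemma y_power_normal_mon: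
  assumes "of_nat p = (0 :: 'k)"
  shows "normal_mon \<alpha> (\<beta>(i := \<beta> i + p)) = weyl_y i ^ p * (normal_mon \<alpha> \<beta> :: ('k::field, 'n::finite) weyl)"
proof -
  have "power_prod index_list weyl_y (\<beta>(i := \<beta> i + p))
      = weyl_y i ^ p * (power_prod index_list weyl_y \<beta> :: ('k, 'n) weyl)"
    by (subst power_prod_raise) (simp_all add: index_list weyl_relations)
  then show ?thesis
    unfolding normal_mon_def
    by (simp only: mult.assoc[symmetric]
        weyl_power_char_central(2)[OF assms, of i "power_prod index_list weyl_x \<alpha>"])
qed

lemma finite_dimensional_if_char_pos:
  fixes \<iota> :: "('k::field, 'n::finite) weyl \<Rightarrow> 'd::division_ring"
  assumes frac: "division_ring_of_fractions \<iota>" and char: "CHAR('k) > 0"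
  shows "finite_dimensional_over (center :: 'd set)"
proof -
  define p where "p = CHAR('k)"
  have p: "of_nat p = (0 :: 'k)" "p > 0" using char by (simp_all add: p_def)
  define M where "M = {\<alpha> :: 'n \<Rightarrow> nat. \<forall>i. \<alpha> i < p}"
  define B where "B = (\<lambda>(\<alpha>, \<beta>). \<iota> (normal_mon \<alpha> \<beta>)) ` (M \<times> M)"
  let ?V = "center_vs.span B"
  have "finite {\<alpha> :: 'n \<Rightarrow> nat. \<forall>i. (i \<in> UNIV \<longrightarrow> \<alpha> i \<in> {..<p}) \<and> (i \<notin> UNIV \<longrightarrow> \<alpha> i = 0)}"
    by (rule finite_set_of_finite_funs) auto
  then have "finite M" by (simp add: M_def)
  then have fin: "finite B" by (simp add: B_def)
  have mon: "\<iota> (normal_mon \<alpha> \<beta>) \<in> ?V" if "\<alpha> \<in> M" "\<beta> \<in> M" for \<alpha> \<beta>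
    using that by (intro center_vs.span_base) (auto simp: B_def)
  have central_mult: "\<iota> (c * a) \<in> ?V" if "\<And>b. c * b = b * c" "\<iota> a \<in> ?V" for c a
    unfolding frac_mult[OF frac] by (intro center_mult_span frac_central[OF frac] that)
  have const: "\<iota> (weyl_const c * a) \<in> ?V" if "\<iota> a \<in> ?V" for c a
    by (intro central_mult weyl_const_central that)
  \<comment> \<open>When multiplication by a generator raises an exponent to \<open>p\<close>, the \<open>p\<close>-th power is central and can
    be split off.\<close>
  have x: "\<iota> (weyl_x i) * v \<in> ?V" if "v \<in> ?V" for i v
  proof (rule left_mult_span[OF _ that])
    fix b assume "b \<in> B"
    then obtain \<alpha> \<beta> where ab: "\<alpha> \<in> M" "\<beta> \<in> M" and b: "b = \<iota> (normal_mon \<alpha> \<beta>)"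
      by (auto simp: B_def)
    have eq: "weyl_x i * normal_mon \<alpha> \<beta> = (normal_mon (\<alpha>(i := \<alpha> i + 1)) \<beta> :: ('k, 'n) weyl)"
      using x_power_normal_mon[of i 1 \<alpha> \<beta>] by simp
    have "\<iota> (normal_mon (\<alpha>(i := \<alpha> i + 1)) \<beta>) \<in> ?V"
    proof (cases "\<alpha> i + 1 < p")
      case True
      with ab show ?thesis by (intro mon) (auto simp: M_def)
    next
      case False
      moreover have "\<alpha> i < p" using ab(1) by (simp add: M_def)
      ultimately have "\<alpha> i + 1 = p" by simp
      then have "normal_mon (\<alpha>(i := \<alpha> i + 1)) \<beta>
          = weyl_x i ^ p * (normal_mon (\<alpha>(i := 0)) \<beta> :: ('k, 'n) weyl)"
        by (simp add: x_power_normal_mon)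
      moreover have "\<iota> (weyl_x i ^ p * normal_mon (\<alpha>(i := 0)) \<beta>) \<in> ?V"
        using ab p(2) by (intro central_mult weyl_power_char_central[OF p(1)] mon) (auto simp: M_def)
      ultimately show ?thesis by simp
    qed
    then show "\<iota> (weyl_x i) * b \<in> ?V" by (simp add: b eq flip: frac_mult[OF frac])
  qed
  have y: "\<iota> (weyl_y i) * v \<in> ?V" if "v \<in> ?V" for i v
  proof (rule left_mult_span[OF _ that])
    fix b assume "b \<in> B"
    then obtain \<alpha> \<beta> where ab: "\<alpha> \<in> M" "\<beta> \<in> M" and b: "b = \<iota> (normal_mon \<alpha> \<beta>)"
      by (auto simp: B_def)
    have 1: "\<iota> (normal_mon \<alpha> (\<beta>(i := \<beta> i + 1))) \<in> ?V"
    proof (cases "\<beta> i + 1 < p")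
      case True
      with ab show ?thesis by (intro mon) (auto simp: M_def)
    next
      case False
      moreover have "\<beta> i < p" using ab(2) by (simp add: M_def)
      ultimately have "\<beta> i + 1 = p" by simp
      then have "normal_mon \<alpha> (\<beta>(i := \<beta> i + 1))
          = weyl_y i ^ p * (normal_mon \<alpha> (\<beta>(i := 0)) :: ('k, 'n) weyl)"
        using y_power_normal_mon[OF p(1), of \<alpha> "\<beta>(i := 0)" i] by simp
      moreover have "\<iota> (weyl_y i ^ p * normal_mon \<alpha> (\<beta>(i := 0))) \<in> ?V"
        using ab p(2) by (intro central_mult weyl_power_char_central[OF p(1)] mon) (auto simp: M_def)
      ultimately show ?thesis by simp
    qed
    have "\<alpha>(i := \<alpha> i - 1) \<in> M" using ab(1) by (auto simp: M_def less_imp_diff_less)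
    then have 2: "\<iota> (of_nat (\<alpha> i) * normal_mon (\<alpha>(i := \<alpha> i - 1)) \<beta>) \<in> ?V"
      unfolding of_nat_weyl by (intro const mon ab)
    show "\<iota> (weyl_y i) * b \<in> ?V"
      using center_vs.span_add[OF 1 2] by (simp add: b y_normal_mon flip: frac_mult[OF frac] frac_add[OF frac])
  qed
  have A: "\<iota> a * v \<in> ?V" if "v \<in> ?V" for a v
  proof (induction a rule: weyl_induct)
    case (const c)
    show ?case by (intro center_mult_span frac_central[OF frac] weyl_const_central that)
  qed (simp_all add: frac_add[OF frac] frac_mult[OF frac] distrib_right center_vs.span_add mult.assoc x y)
  have "normal_mon (\<lambda>i. 0) (\<lambda>i. 0) = (1 :: ('k, 'n) weyl)"
    by (simp add: normal_mon_def power_prod_zero)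
  moreover have "\<iota> (normal_mon (\<lambda>i. 0) (\<lambda>i. 0)) \<in> ?V"
    by (intro mon) (simp_all add: M_def p(2))
  ultimately have one: "1 \<in> ?V" by (simp add: frac_one[OF frac])
  have "d \<in> ?V" for d
  proof -
    obtain a b where ab: "b \<noteq> 0" "d = \<iota> a * inverse (\<iota> b)"
      using frac_exhaust[OF frac] by blast
    have "inverse (\<iota> b) \<in> ?V"
      by (rule inverse_in_finite_span[OF fin _ one A]) (simp_all add: ab frac_eq_0_iff[OF frac])
    then show ?thesis unfolding ab(2) by (rule A)
  qed
  then show ?thesis using finite_dimensional_if_span[OF fin] by blast
qed

section \<open>Characteristic zero\<close>

lemma weyl_op_pvar_y:
  fixes a :: "('k::field, 'n::finite) weyl" and i :: 'n
  shows "weyl_op a (pvar (y_index i) * q) = pvar (y_index i) * weyl_op a q"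
  by (induction a rule: weyl_induct)
    (simp_all add: weyl_op_simps distrib_left pd_pvar_mult mult.left_commute)

text \<open>
  The polynomials \<open>Y\<^sub>i\<close> commute with the whole action, so \<open>a y\<^sub>i\<close> has symbol \<open>Y\<^sub>i\<close> times that of \<open>a\<close>, whereas
  \<open>y\<^sub>i a\<close> also has the derivative.
\<close>

lemma symbol_y_commutator: "symbol (weyl_y i * a - a * weyl_y i) = pd (x_index i) (symbol a)"
proof -
  have "symbol (a * weyl_y i) = pvar (y_index i) * symbol a"
    using weyl_op_pvar_y[of a i 1] by (simp add: symbol_def weyl_op_simps pd_one)
  then show ?thesis by (simp add: symbol_simps)
qed

lemma symbol_x_commutator: "symbol (a * weyl_x i - weyl_x i * a) = pd (y_index i) (symbol a)"
proof -
  have "weyl_op a (pvar (x_index i)) = pvar (x_index i) * symbol a + pd (y_index i) (symbol a)"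
  proof (induction a rule: weyl_induct)
    case (const c)
    show ?case by (simp add: symbol_simps weyl_op_simps pd_pconst)
  next
    case (add a b)
    then show ?case by (simp add: symbol_simps weyl_op_simps pd_add distrib_left add_ac)
  next
    case (x j a)
    then show ?case by (simp add: symbol_simps weyl_op_simps pd_pvar_mult distrib_left mult.left_commute)
  next
    case (y j a)
    then show ?case
      by (simp add: symbol_simps weyl_op_simps pd_pvar_mult pd_add distrib_left mult.left_commute
          pd_commute[of "x_index j"] add_ac)
  qed
  then show ?thesis by (simp add: symbol_simps) (simp add: symbol_def weyl_op_simps)
qed

text \<open>
  In characteristic 0 the vanishing of a partial derivative means that the variable does not occur. Only
  variables of generators are considered, but normal ordering sends the other ones to 1.
\<close>

lemma const_if_pd_symbol_zero:
  fixes a :: "('k::field, 'n::finite) weyl"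
  assumes "CHAR('k) = 0"
    and "\<And>i :: 'n. pd (x_index i) (symbol a) = 0" "\<And>i :: 'n. pd (y_index i) (symbol a) = 0"
  shows "\<exists>c. a = weyl_const c"
proof -
  have zero: "Poly_Mapping.lookup m (x_index i) = 0" "Poly_Mapping.lookup m (y_index i) = 0"
    if "m \<in> Poly_Mapping.keys (symbol a)" for m and i :: 'n
    using that pd_zero_imp_lookup_zero[OF assms(2) assms(1), of m i]
      pd_zero_imp_lookup_zero[OF assms(3) assms(1), of m i] by (auto simp: in_keys_iff)
  have "(normal_order (symbol a) :: ('k, 'n) weyl)
      = (\<Sum>m\<in>Poly_Mapping.keys (symbol a). weyl_const (Poly_Mapping.lookup (symbol a) m))"
    unfolding normal_order_def
    by (intro sum.cong) (simp_all add: zero normal_mon_def power_prod_zero)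
  moreover have "\<exists>c. (\<Sum>m\<in>A. weyl_const (f m) :: ('k, 'n) weyl) = weyl_const c"
    if "finite A" for A :: "(nat \<Rightarrow>\<^sub>0 nat) set" and f
    using that
  proof (induction A rule: finite_induct)
    case empty
    show ?case by (intro exI[of _ 0]) (simp add: weyl_const_simps)
  next
    case (insert m A)
    then show ?case by (metis sum.insert weyl_const_simps(3))
  qed
  ultimately show ?thesis using normal_order_symbol[of a] by (metis finite_keys)
qed

text \<open>
  For \<open>z\<close> central, the \<open>b\<close> with \<open>z b \<in> A\<close> form a nonzero two-sided ideal \<open>J\<close>, here without its zero
  element. Commutators with generators keep it and differentiate symbols, so a nonzero element of \<open>J\<close> with
  a symbol of least total degree is a constant. Hence \<open>z\<close> lies in \<open>A\<close>, and as all partial derivatives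
  of its symbol vanish, it is a constant.
\<close>

lemma center_subset_const:
  fixes \<iota> :: "('k::field, 'n::finite) weyl \<Rightarrow> 'd::division_ring"
  assumes frac: "division_ring_of_fractions \<iota>" and char: "CHAR('k) = 0"
  shows "(center :: 'd set) \<subseteq> range (\<lambda>c. \<iota> (weyl_const c))"
proof
  fix z :: 'd
  assume "z \<in> center"
  then have z: "z * d = d * z" for d by (simp add: center_def)
  define J where "J = {b :: ('k, 'n) weyl. b \<noteq> 0 \<and> (\<exists>a. z * \<iota> b = \<iota> a)}"
  let ?size = "\<lambda>b :: ('k, 'n) weyl. degree (graded (weight (\<lambda>v. 1)) (symbol b))"
  have J_commutator: "b * c - c * b = 0 \<or> b * c - c * b \<in> J" if b: "b \<in> J" for b c
  proof -
    obtain a where a: "z * \<iota> b = \<iota> a" using b unfolding J_def by blast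
    have "z * \<iota> (b * c - c * b) = (z * \<iota> b) * \<iota> c - (z * \<iota> c) * \<iota> b"
      by (simp add: frac_mult[OF frac] frac_diff[OF frac] right_diff_distrib mult.assoc)
    also have "(z * \<iota> c) * \<iota> b = \<iota> c * (z * \<iota> b)" by (simp add: z[of "\<iota> c"] mult.assoc)
    finally have "z * \<iota> (b * c - c * b) = \<iota> (a * c - c * a)"
      by (simp add: a frac_mult[OF frac] frac_diff[OF frac])
    then show ?thesis by (auto simp: J_def)
  qed
  have J_uminus: "b \<in> J" if b: "- b \<in> J" for b
  proof -
    obtain a where a: "z * \<iota> (- b) = \<iota> a" "- b \<noteq> 0" using b unfolding J_def by blast
    then have "z * \<iota> b = \<iota> (- a)"
      using frac_diff[OF frac, of 0] by (simp add: frac_zero[OF frac] minus_equation_iff)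
    with a(2) show ?thesis by (auto simp: J_def)
  qed
  have smaller: "?size b' < ?size b" if "symbol b' = pd v (symbol b)" "b' \<noteq> 0" for b b' v
  proof -
    have "below (weight (\<lambda>v. 1)) (Suc (?size b)) (symbol b)" by (simp add: below_Suc_iff)
    from below_pd[OF weight_add this, of v] have "below (weight (\<lambda>v. 1)) (?size b) (symbol b')"
      by (simp add: that(1) weight_single)
    moreover have "symbol b' \<noteq> 0" using that(2) by (simp add: symbol_eq_0_iff)
    ultimately show ?thesis by (simp add: below_degree)
  qed
  obtain a b where ab: "b \<noteq> 0" "z = \<iota> a * inverse (\<iota> b)" using frac_exhaust[OF frac] by blast
  then have "z * \<iota> b = \<iota> a" by (simp add: mult.assoc frac_eq_0_iff[OF frac])
  with ab(1) have "b \<in> J" by (auto simp: J_def)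
  then obtain b where b: "b \<in> J" "\<And>b'. b' \<in> J \<Longrightarrow> ?size b \<le> ?size b'"
    using ex_has_least_nat[of "\<lambda>b. b \<in> J" b ?size] by blast
  have "pd (x_index i) (symbol b) = 0" for i :: 'n
  proof (rule ccontr)
    let ?c = "weyl_y i * b - b * weyl_y i"
    assume "pd (x_index i) (symbol b) \<noteq> 0"
    then have c: "?c \<noteq> 0" using symbol_y_commutator[of i b] symbol_eq_0_iff[of ?c] by auto
    then have "- ?c \<in> J" using J_commutator[OF b(1), of "weyl_y i"] by auto
    then have "?c \<in> J" by (rule J_uminus)
    from b(2)[OF this] smaller[OF symbol_y_commutator c] show False by simp
  qed
  moreover have "pd (y_index i) (symbol b) = 0" for i :: 'n
  proof (rule ccontr)
    let ?c = "b * weyl_x i - weyl_x i * b"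
    assume "pd (y_index i) (symbol b) \<noteq> 0"
    then have c: "?c \<noteq> 0" using symbol_x_commutator[of b i] symbol_eq_0_iff[of ?c] by auto
    then have "?c \<in> J" using J_commutator[OF b(1), of "weyl_x i"] by auto
    from b(2)[OF this] smaller[OF symbol_x_commutator c] show False by simp
  qed
  ultimately obtain c where c: "b = weyl_const c" using const_if_pd_symbol_zero[OF char] by blast
  obtain a where a: "b \<noteq> 0" "z * \<iota> b = \<iota> a" using b(1) unfolding J_def by blast
  then have "c \<noteq> 0" using c by (auto simp: weyl_const_simps)
  define a' where "a' = a * weyl_const (inverse c)"
  have "b * weyl_const (inverse c) = 1"
    using \<open>c \<noteq> 0\<close> weyl_const_simps(4)[of c "inverse c"] by (simp add: c weyl_const_simps)
  then have "z * \<iota> b * \<iota> (weyl_const (inverse c)) = z"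
    by (simp add: mult.assoc frac_one[OF frac] flip: frac_mult[OF frac])
  then have za: "z = \<iota> a'" by (simp add: a a'_def frac_mult[OF frac])
  have comm: "a' * d = d * a'" for d
    using z[of "\<iota> d"] by (simp add: za frac_eq_iff[OF frac] flip: frac_mult[OF frac])
  have "pd (x_index i) (symbol a') = 0" "pd (y_index i) (symbol a') = 0" for i :: 'n
    using symbol_y_commutator[of i a'] symbol_x_commutator[of a' i] by (simp_all add: comm symbol_simps)
  from const_if_pd_symbol_zero[OF char this] za show "z \<in> range (\<lambda>c. \<iota> (weyl_const c))" by blast
qed

section \<open>Affine and finite dimensional division rings\<close>

lemma subring_generated_mono:
  assumes "S \<subseteq> T"
  shows "subring_generated S \<subseteq> subring_generated T"
proof
  fix a
  assume "a \<in> subring_generated S"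
  then show "a \<in> subring_generated T"
    by induction (use assms in \<open>auto intro: subring_generated.intros\<close>)
qed

lemma affine_over_mono: "affine_over F \<Longrightarrow> F \<subseteq> F' \<Longrightarrow> affine_over F'"
  unfolding affine_over_def by (metis subring_generated_mono Un_mono subset_refl top.extremum_uniqueI)

lemma affine_over_if_finite_dimensional:
  assumes "finite_dimensional_over F"
  shows "affine_over F"
proof -
  obtain B where B: "finite B" "\<And>d. \<exists>c. (\<forall>b\<in>B. c b \<in> F) \<and> d = (\<Sum>b\<in>B. c b * b)"
    using assms unfolding finite_dimensional_over_def by blast
  let ?R = "subring_generated (F \<union> B)"
  have zero: "0 \<in> ?R" using subring_generated.diff[OF subring_generated.one subring_generated.one] by simp
  have add: "a + b \<in> ?R" if "a \<in> ?R" "b \<in> ?R" for a b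
    using subring_generated.diff[OF that(1) subring_generated.diff[OF zero that(2)]] by simp
  have "d \<in> ?R" for d
  proof -
    obtain c where c: "\<forall>b\<in>B. c b \<in> F" "d = (\<Sum>b\<in>B. c b * b)" using B(2) by blast
    have "(\<Sum>b\<in>A. c b * b) \<in> ?R" if "A \<subseteq> B" for A
      using finite_subset[OF that B(1)] that
    proof (induction A rule: finite_induct)
      case (insert b A)
      then have "c b * b \<in> ?R"
        using c(1) by (intro subring_generated.mult subring_generated.incl) auto
      with insert show ?case by (simp add: add)
    qed (simp add: zero)
    from this[of B] show ?thesis by (simp add: c(2))
  qed
  then show ?thesis unfolding affine_over_def using B(1) by blast
qed

theorem theoremA:
  fixes \<iota> :: "('k::field, 'n::finite) weyl \<Rightarrow> 'd::division_ring"
  assumes "division_ring_of_fractions \<iota>"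
  shows "(affine_over (center :: 'd set) \<longleftrightarrow> finite_dimensional_over (center :: 'd set)) \<and>
    (finite_dimensional_over (center :: 'd set) \<longleftrightarrow> CHAR('k) > 0) \<and>
    \<not> affine_over (range (\<lambda>c. \<iota> (weyl_const c)))"
proof -
  interpret filtered_fractions \<iota> y_degree
    by unfold_locales (fact assms y_degree_mult y_degree_diff y_degree_commutator)+
  \<comment> \<open>Already the larger ring \<open>A\<close> in place of \<open>k\<close> does not admit finitely many generators.\<close>
  have not_affine: "\<not> affine_over (range (\<lambda>c. \<iota> (weyl_const c)))"
  proof
    assume "affine_over (range (\<lambda>c. \<iota> (weyl_const c)))"
    then have "affine_over (range \<iota>)" by (rule affine_over_mono) blast
    then show False
      using not_finitely_generated exists_nondivisor unfolding affine_over_def by blast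
  qed
  moreover have "CHAR('k) > 0" if "affine_over (center :: 'd set)"
    using not_affine affine_over_mono[OF that center_subset_const[OF assms]] by blast
  ultimately show ?thesis
    using affine_over_if_finite_dimensional[of "center :: 'd set"]
      finite_dimensional_if_char_pos[OF assms] by blast
qed

end
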